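(* Let $\kappa > \frac{41}{83}$. Then there exists $p_0=p_0(\kappa)$ such that for every prime $p\ge p_0$ and every multiplicative subgroup $R\subseteq \mathbb{F}_p^*$ with $|R| \ge p^{\kappa}$ we have $\mathbb{F}^*_p \subseteq 6R$.
   Context: $6R=\{r_1+\dots+r_6: r_i\in R\}$ denotes the $6$-fold sumset of $R$. *)

theory Defs
  imports "HOL-Number_Theory.Residues" "HOL-Algebra.Multiplicative_Group"
begin

fun sumset :: "('a, 'b) ring_scheme \<Rightarrow> nat \<Rightarrow> 'a set \<Rightarrow> 'a set" where
  "sumset S 0 R = {\<zero>\<^bsub>S\<^esub>}"
| "sumset S (Suc k) R = {x \<oplus>\<^bsub>S\<^esub> r | x r. x \<in> sumset S k R \<and> r \<in> R}"

end

theory Submission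
  imports Defs "HOL-Computational_Algebra.Polynomial" "HOL-Analysis.Analysis" "HOL-Real_Asymp.Real_Asymp"
begin

text \<open>
  Write $t = |R|$ and $S = R + R$, and let $\rho$ be the largest modulus of a nontrivial Fourier
  coefficient of $R$, attained at $\xi$. If $l \notin 6R$, then $lR$ is disjoint from $S + S + R + R$,
  and Parseval gives $|S| t^3 \le p \rho^3$.

  For $16 t^5 \le p^3$, Stepanov's method shows that at most $O((t/k)^3)$ nonzero elements have $k$ or more
  representations as a difference of elements of $R$. Hence the third moment $E_3$ of the number of
  representations is $O(t^3 \log t)$, the additive energy $E$ satisfies $E^2 \le t^2 E_3$, and
  $|S| \ge t^4 / E$. Since $t \rho^2 = \sum_{a, b \in R} \hat R(\xi (a - b))$, the Katz-Koester inclusion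
  $R + (R \cap (R + s)) \subseteq S \cap (S + s)$ and the Cauchy-Schwarz inequality lead to
  $t^4 \rho^4 \le E_3 \sum_{a, b \in R} |\hat S(\xi (a - b))|^2 \le E_3 (t |S|^2 + E^{1/2} p |S| t^{-1/2})$.
  Up to logarithms these bounds force $t^{57} \le p^{28}$ or $t^{21} \le p^{10}$, and both $28/57$ and $10/21$ are smaller than
  $41/83$. For larger $t$ the trivial bound $\rho \le p^{1/2}$ suffices.
\<close>

section \<open>Integer polynomials modulo a prime\<close>

text \<open>The critical range is t just below p^(1/2): there invariance and Parseval give only
  \<rho> \<le> p^(1/2), which is weaker than the trivial bound t, so a gain has to come from the
  additive behaviour of R. Stepanov's method supplies it as long as exponents of size t B stay below
  p, where B is about (h t)^(1/3) and h \<le> t; this allows t up to about p^(3/5). The argument for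
  large t already gives a contradiction beyond p^(7/12), so the two ranges cover everything.
  Invariance under R is exploited throughout: one missing l excludes the whole coset lR and thereby
  yields the third factor \<rho>, and every nontrivial Fourier coefficient is repeated t times. Up
  to constants and logarithms, E \<le> t^(5/2) and |S| \<ge> t^(3/2). The term t |S|^2 comes from
  the diagonal a = b. If it dominates, eliminating \<rho> leaves t^(21/2) \<le> p^5; otherwise it
  leaves t^(57/4) \<le> p^7.\<close>

text \<open>Order of vanishing at least M at x over the field with p elements, expressed as
  membership of F in the ideal of Z[X] generated by p and (X - x)^M.\<close>

definition vanishes_mod :: "int \<Rightarrow> nat \<Rightarrow> int \<Rightarrow> int poly \<Rightarrow> bool" where
  "vanishes_mod p M x F \<longleftrightarrow> (\<exists>G. [:p:] dvd F - [:-x, 1:] ^ M * G)"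

lemma poly_mod_root_split:
  fixes G :: "int poly"
  assumes "p dvd poly G x"
  obtains G' where "[:p:] dvd G - [:-x, 1:] * G'"
proof -
  have "poly (G - [:poly G x:]) x = 0"
    by simp
  then obtain G' where "G - [:poly G x:] = [:-x, 1:] * G'"
    unfolding poly_eq_0_iff_dvd by (elim dvdE)
  then have "G - [:-x, 1:] * G' = [:poly G x:]"
    by (simp add: algebra_simps)
  with assms have "[:p:] dvd G - [:-x, 1:] * G'"
    by simp
  then show ?thesis
    by (rule that)
qed

lemma const_dvd_imp_dvd_poly:
  fixes F :: "int poly"
  assumes "[:p:] dvd F"
  shows "p dvd poly F x"
  using assms by (auto elim!: dvdE)

lemma not_const_dvd_linear_power:
  fixes p :: int
  assumes "prime p"
  shows "\<not> [:p:] dvd [:-x, 1:] ^ M"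
proof
  assume "[:p:] dvd [:-x, 1:] ^ M"
  then have "p dvd poly ([:-x, 1:] ^ M) (x + 1)"
    by (rule const_dvd_imp_dvd_poly)
  then show False
    using assms by (simp add: poly_power not_prime_unit)
qed

text \<open>The constant p is a prime element of Z[X] and does not divide a monic power, so that
  power cancels modulo p.\<close>

lemma const_dvd_linear_power_mult_iff:
  fixes p :: int
  assumes "prime p"
  shows "[:p:] dvd [:-x, 1:] ^ M * G \<longleftrightarrow> [:p:] dvd G"
proof -
  have "prime_elem [:p:]"
    using assms by (intro lift_prime_elem_poly prime_imp_prime_elem)
  then show ?thesis
    using not_const_dvd_linear_power[OF assms] by (simp add: prime_elem_dvd_mult_iff)
qed

lemma vanishes_mod_0 [simp]: "vanishes_mod p 0 x F"
  unfolding vanishes_mod_def by (rule exI[of _ F]) simp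

lemma vanishes_modI: "F = [:-x, 1:] ^ M * G + smult p H \<Longrightarrow> vanishes_mod p M x F"
  unfolding vanishes_mod_def by (intro exI[of _ G] dvdI[of _ _ H]) simp

lemma vanishes_mod_mono:
  assumes "vanishes_mod p M x F" "N \<le> M"
  shows "vanishes_mod p N x F"
proof -
  obtain G where "[:p:] dvd F - [:-x, 1:] ^ M * G"
    using assms(1) unfolding vanishes_mod_def by blast
  moreover have "[:-x, 1:] ^ M = [:-x, 1:] ^ N * [:-x, 1:] ^ (M - N)"
    using assms(2) by (simp flip: power_add)
  ultimately show ?thesis
    unfolding vanishes_mod_def by (intro exI[of _ "[:-x, 1:] ^ (M - N) * G"]) (simp add: mult.assoc)
qed

lemma vanishes_mod_cong:
  assumes "vanishes_mod p M x F" "[:p:] dvd F - F'"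
  shows "vanishes_mod p M x F'"
proof -
  obtain G where "[:p:] dvd F - [:-x, 1:] ^ M * G"
    using assms(1) unfolding vanishes_mod_def by blast
  then have "[:p:] dvd (F - [:-x, 1:] ^ M * G) - (F - F')"
    using assms(2) by (rule dvd_diff)
  then show ?thesis
    unfolding vanishes_mod_def by (intro exI[of _ G]) (simp add: algebra_simps)
qed

lemma vanishes_mod_Suc:
  assumes "[:p:] dvd F - [:-x, 1:] ^ M * G" "p dvd poly G x"
  shows "vanishes_mod p (Suc M) x F"
proof -
  obtain G' where G': "[:p:] dvd G - [:-x, 1:] * G'"
    using poly_mod_root_split assms(2) by blast
  have "[:p:] dvd (F - [:-x, 1:] ^ M * G) + [:-x, 1:] ^ M * (G - [:-x, 1:] * G')"
    using assms(1) G' by (intro dvd_add dvd_mult)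
  also have "\<dots> = F - [:-x, 1:] ^ Suc M * G'"
    by (simp only: power_Suc2 right_diff_distrib mult.assoc add_diff_eq diff_add_cancel)
  finally show ?thesis
    unfolding vanishes_mod_def by blast
qed

lemma pderiv_power_Suc_mult:
  fixes L G :: "int poly"
  assumes "pderiv L = 1"
  shows "pderiv (L ^ Suc n * G) = L ^ n * (smult (of_nat (Suc n)) G + L * pderiv G)"
  using assms by (simp add: pderiv_mult pderiv_power_Suc algebra_simps del: power_Suc) (simp add: algebra_simps)

lemma pderiv_linear: "pderiv [:-x, 1 :: int:] = 1"
  by (simp add: pderiv_pCons)

text \<open>Each differentiation lowers the power by one and multiplies the value of the cofactor at
  x by the old exponent; the other term of the product rule keeps a factor X - x.\<close>

lemma higher_pderiv_linear_power_mult: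
  fixes G :: "int poly"
  shows "poly ((pderiv ^^ n) ([:-x, 1:] ^ n * G)) x = fact n * poly G x"
proof (induction n arbitrary: G)
  case (Suc n)
  have "(pderiv ^^ Suc n) ([:-x, 1:] ^ Suc n * G) =
      (pderiv ^^ n) ([:-x, 1:] ^ n * (smult (of_nat (Suc n)) G + [:-x, 1:] * pderiv G))"
    by (simp only: funpow_Suc_right o_apply pderiv_power_Suc_mult[OF pderiv_linear])
  then show ?case
    by (simp only: Suc) (simp add: algebra_simps)
qed simp

lemma higher_pderiv_diff_int:
  fixes F G :: "int poly"
  shows "(pderiv ^^ n) (F - G) = (pderiv ^^ n) F - (pderiv ^^ n) G"
  by (induction n) (simp_all add: pderiv_diff)

text \<open>The Taylor coefficient of (X - x)^n is the n-th derivative at x divided by n!, and M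
  \<le> p keeps n! invertible for every n < M.\<close>

lemma vanishes_mod_if_derivs:
  fixes p :: int
  assumes "prime p" "int M \<le> p" "\<And>n. n < M \<Longrightarrow> p dvd poly ((pderiv ^^ n) F) x"
  shows "vanishes_mod p M x F"
  using assms(2,3)
proof (induction M)
  case (Suc M)
  then have "vanishes_mod p M x F"
    by simp
  then obtain G where G: "[:p:] dvd F - [:-x, 1:] ^ M * G"
    unfolding vanishes_mod_def by blast
  then obtain H where "F - [:-x, 1:] ^ M * G = smult p H"
    by (auto elim!: dvdE)
  then have "(pderiv ^^ M) F - (pderiv ^^ M) ([:-x, 1:] ^ M * G) = smult p ((pderiv ^^ M) H)"
    by (metis higher_pderiv_diff_int higher_pderiv_smult)
  then have "poly ((pderiv ^^ M) F) x - fact M * poly G x = p * poly ((pderiv ^^ M) H) x"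
    by (metis higher_pderiv_linear_power_mult poly_diff poly_smult)
  moreover have "p dvd poly ((pderiv ^^ M) F) x"
    using Suc.prems by simp
  ultimately have "p dvd poly ((pderiv ^^ M) F) x - p * poly ((pderiv ^^ M) H) x"
      and "fact M * poly G x = poly ((pderiv ^^ M) F) x - p * poly ((pderiv ^^ M) H) x"
    by auto
  then have "p dvd fact M * poly G x"
    by simp
  moreover have "\<not> p dvd fact M"
  proof -
    have "prime (nat p)" "p > 0"
      using assms(1) prime_gt_0_int by auto
    moreover have "nat p > M"
      using Suc.prems(1) by linarith
    ultimately have "\<not> nat p dvd fact M"
      using prime_dvd_fact_iff[of "nat p" M] by simp
    moreover have "(fact M :: int) = int (fact M)"
      by simp
    ultimately show ?thesis
      using \<open>p > 0\<close> by (metis int_dvd_int_iff int_nat_eq less_imp_le)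
  qed
  ultimately have "p dvd poly G x"
    using assms(1) prime_dvd_mult_iff by blast
  with G show ?case
    by (rule vanishes_mod_Suc)
qed simp

text \<open>Locally at y the factor Q is a unit modulo p, so it does not contribute to the order of
  vanishing.\<close>

lemma vanishes_mod_cancel:
  fixes p :: int
  assumes "prime p" "\<not> p dvd poly Q y" "vanishes_mod p M y (Q * G)"
  shows "vanishes_mod p M y G"
  using assms(3)
proof (induction M)
  case (Suc M)
  obtain K where K: "[:p:] dvd Q * G - [:-y, 1:] ^ Suc M * K"
    using Suc.prems unfolding vanishes_mod_def by blast
  have "vanishes_mod p M y G"
    using Suc vanishes_mod_mono[of p "Suc M" y "Q * G" M] by simp
  then obtain G1 where G1: "[:p:] dvd G - [:-y, 1:] ^ M * G1"
    unfolding vanishes_mod_def by blast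
  have "[:p:] dvd (Q * G - [:-y, 1:] ^ Suc M * K) - Q * (G - [:-y, 1:] ^ M * G1)"
    using dvd_diff[OF K dvd_mult[OF G1, of Q]] .
  also have "\<dots> = [:-y, 1:] ^ M * (Q * G1 - [:-y, 1:] * K)"
  proof -
    have "(Q * G - L ^ Suc M * K) - Q * (G - L ^ M * G1) = L ^ M * (Q * G1 - L * K)" for L
      by (simp add: algebra_simps)
    then show ?thesis .
  qed
  finally have "[:p:] dvd Q * G1 - [:-y, 1:] * K"
    using const_dvd_linear_power_mult_iff[OF assms(1)] by blast
  then have "p dvd poly (Q * G1 - [:-y, 1:] * K) y"
    by (rule const_dvd_imp_dvd_poly)
  then have "p dvd poly G1 y"
    using assms(1,2) by (simp add: prime_dvd_mult_iff)
  with G1 show ?case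
    by (rule vanishes_mod_Suc)
qed simp

text \<open>Linear factors at points distinct modulo p are coprime over the field, so the separate
  divisibilities multiply.\<close>

lemma vanishes_mod_prod:
  fixes p :: int
  assumes "prime p" "finite A" "\<And>x y. x \<in> A \<Longrightarrow> y \<in> A \<Longrightarrow> p dvd x - y \<Longrightarrow> x = y"
    and "\<And>x. x \<in> A \<Longrightarrow> vanishes_mod p M x F"
  obtains G where "[:p:] dvd F - (\<Prod>x\<in>A. [:-x, 1:] ^ M) * G"
proof -
  have "\<exists>G. [:p:] dvd F - (\<Prod>x\<in>A. [:-x, 1:] ^ M) * G"
    using assms(2-)
  proof (induction A rule: finite_induct)
    case empty
    show ?case
      by (intro exI[of _ F]) simp
  next
    case (insert y A)
    let ?Q = "\<Prod>x\<in>A. [:-x, 1:] ^ M"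
    obtain G where G: "[:p:] dvd F - ?Q * G"
      using insert by blast
    have "\<not> p dvd poly ?Q y"
    proof
      assume "p dvd poly ?Q y"
      then have "p dvd (\<Prod>x\<in>A. (y - x) ^ M)"
        by (simp add: poly_prod poly_power)
      then obtain x where "x \<in> A" "p dvd (y - x) ^ M"
        using prime_dvd_prod_iff[OF insert.hyps(1) assms(1), of "\<lambda>x. (y - x) ^ M"] by auto
      then have "p dvd y - x"
        using prime_dvd_power[OF assms(1)] by simp
      with \<open>x \<in> A\<close> insert.prems(1)[of y x] insert.hyps show False
        by auto
    qed
    moreover have "vanishes_mod p M y (?Q * G)"
      using vanishes_mod_cong[OF insert.prems(2) G] by simp
    ultimately have "vanishes_mod p M y G"
      using vanishes_mod_cancel[OF assms(1)] by simp
    then obtain K where K: "[:p:] dvd G - [:-y, 1:] ^ M * K"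
      unfolding vanishes_mod_def by blast
    have "[:p:] dvd (F - ?Q * G) + ?Q * (G - [:-y, 1:] ^ M * K)"
      using G K by (intro dvd_add dvd_mult)
    also have "\<dots> = F - ([:-y, 1:] ^ M * ?Q) * K"
      by (simp only: right_diff_distrib mult_ac add_diff_eq diff_add_cancel)
    also have "[:-y, 1:] ^ M * ?Q = (\<Prod>x\<in>insert y A. [:-x, 1:] ^ M)"
      using insert.hyps by simp
    finally show ?case
      by blast
  qed
  then show ?thesis
    using that by blast
qed

lemma monic_mult_degree_mod:
  fixes p :: int and P G F :: "int poly"
  assumes "p > 1" "lead_coeff P = 1" "Polynomial.degree F < Polynomial.degree P" "[:p:] dvd F - P * G"
  shows "[:p:] dvd F"
proof -
  \<comment> \<open>Over Z the leading coefficient of G may be divisible by p. After reduction a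
    nonzero cofactor has a leading coefficient that is nonzero modulo p, and P is monic, so the top
    coefficient of the product cannot vanish.\<close>
  define G' where "G' = map_poly (\<lambda>c. c mod p) G"
  have coeff_G': "Polynomial.coeff G' i = Polynomial.coeff G i mod p" for i
    unfolding G'_def by (simp add: coeff_map_poly)
  then have "[:p:] dvd G - G'"
    by (simp add: const_poly_dvd_iff)
  then have "[:p:] dvd (F - P * G) + P * (G - G')"
    using assms(4) by (intro dvd_add dvd_mult)
  then have *: "[:p:] dvd F - P * G'"
    by (simp add: algebra_simps)
  have "G' = 0"
  proof (rule ccontr)
    assume "G' \<noteq> 0"
    let ?k = "Polynomial.degree P + Polynomial.degree G'"
    have "p dvd Polynomial.coeff (F - P * G') ?k"
      using * by (simp add: const_poly_dvd_iff)
    moreover have "Polynomial.coeff F ?k = 0"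
      using assms(3) by (intro coeff_eq_0) simp
    moreover have "Polynomial.coeff (P * G') ?k = lead_coeff G'"
      using assms(2) by (simp add: coeff_mult_degree_sum)
    ultimately have "p dvd lead_coeff G'"
      by simp
    moreover have "lead_coeff G' = lead_coeff G' mod p"
      using coeff_G' by simp
    ultimately show False
      using \<open>G' \<noteq> 0\<close> by (metis dvd_imp_mod_0 leading_coeff_0_iff)
  qed
  with * show ?thesis
    by simp
qed

lemma vanishes_mod_degree:
  fixes p :: int
  assumes "prime p" "finite A" "\<And>x y. x \<in> A \<Longrightarrow> y \<in> A \<Longrightarrow> p dvd x - y \<Longrightarrow> x = y"
    and "\<And>x. x \<in> A \<Longrightarrow> vanishes_mod p M x F" "Polynomial.degree F < M * card A"
  shows "[:p:] dvd F"
proof -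
  obtain G where G: "[:p:] dvd F - (\<Prod>x\<in>A. [:-x, 1:] ^ M) * G"
    using vanishes_mod_prod[OF assms(1-4)] by blast
  have "lead_coeff (\<Prod>x\<in>A. [:-x, 1:] ^ M) = 1"
    by (simp only: lead_coeff_prod lead_coeff_power) simp
  moreover have "Polynomial.degree (\<Prod>x\<in>A. [:-x, 1:] ^ M) = (\<Sum>x\<in>A. M)"
    by (subst degree_prod_sum_eq) (auto simp: degree_power_eq)
  ultimately show ?thesis
    using monic_mult_degree_mod[OF _ _ _ G] assms(1,5) prime_gt_1_int by (simp add: mult.commute)
qed

section \<open>Sparse polynomials with a multiple zero at 1\<close>

lemma smult_sum_right:
  fixes f :: "'b \<Rightarrow> int poly"
  shows "smult c (sum f A) = (\<Sum>x\<in>A. smult c (f x))"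
  by (induction A rule: infinite_finite_induct) (simp_all add: smult_add_right)

lemma euler_operator_power_Suc_mult:
  fixes L G H X :: "int poly"
  assumes "pderiv L = 1"
  shows "X * pderiv (L ^ Suc n * G + smult p H) - smult e (L ^ Suc n * G + smult p H) =
    L ^ n * (X * (smult (of_nat (Suc n)) G + L * pderiv G) - smult e (L * G))
    + smult p (X * pderiv H - smult e H)"
  by (simp only: pderiv_add pderiv_smult pderiv_power_Suc_mult[OF assms])
    (simp add: algebra_simps smult_add_right smult_diff_right)

lemma sparse_poly_vanishes_mod:
  fixes p :: int and c :: "nat \<Rightarrow> int"
  assumes "prime p" "finite K" "\<And>k. k \<in> K \<Longrightarrow> int k < p"
    and "vanishes_mod p (card K) 1 (\<Sum>k\<in>K. Polynomial.monom (c k) k)" "k \<in> K"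
  shows "p dvd c k"
  using assms(2-)
\<comment> \<open>The operator $X \frac{d}{dX} - e$ removes the exponent $e$ and lowers the order of vanishing by one.\<close>
proof (induction K arbitrary: c k rule: finite_induct)
  case (insert e K)
  let ?L = "[:-1, 1:] :: int poly"
  let ?H = "\<Sum>k\<in>insert e K. Polynomial.monom (c k) k"
  obtain G where "[:p:] dvd ?H - ?L ^ Suc (card K) * G"
    using insert.prems(2) insert.hyps unfolding vanishes_mod_def by auto
  then obtain H where H: "?H - ?L ^ Suc (card K) * G = smult p H"
    by (auto elim!: dvdE)
  then have H_eq: "?H = ?L ^ Suc (card K) * G + smult p H"
    by (simp add: algebra_simps)
  let ?X = "Polynomial.monom 1 1 :: int poly"
  have "?X * pderiv ?H - smult (int e) ?H = (\<Sum>k\<in>K. Polynomial.monom (c k * (int k - int e)) k)"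
  proof -
    have *: "?X * pderiv (Polynomial.monom (c k) k) - smult (int e) (Polynomial.monom (c k) k) =
        Polynomial.monom (c k * (int k - int e)) k" for k
      by (cases k) (simp_all add: pderiv_monom mult_monom smult_monom diff_monom minus_monom algebra_simps)
    have "?X * pderiv ?H - smult (int e) ?H =
        (\<Sum>k\<in>insert e K. ?X * pderiv (Polynomial.monom (c k) k) - smult (int e) (Polynomial.monom (c k) k))"
      by (simp only: higher_pderiv_sum[of 1, simplified] sum_distrib_left smult_sum_right sum_subtractf)
    also have "\<dots> = (\<Sum>k\<in>insert e K. Polynomial.monom (c k * (int k - int e)) k)"
      by (simp only: *)
    finally show ?thesis
      using insert.hyps by simp
  qed
  moreover have "vanishes_mod p (card K) 1 (?X * pderiv ?H - smult (int e) ?H)"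
  proof -
    have "?X * pderiv ?H - smult (int e) ?H =
        ?L ^ card K * (?X * (smult (of_nat (Suc (card K))) G + ?L * pderiv G) - smult (int e) (?L * G))
        + smult p (?X * pderiv H - smult (int e) H)"
      unfolding H_eq by (rule euler_operator_power_Suc_mult[OF pderiv_linear])
    then show ?thesis
      by (rule vanishes_modI)
  qed
  ultimately have van: "vanishes_mod p (card K) 1 (\<Sum>k\<in>K. Polynomial.monom (c k * (int k - int e)) k)"
    by simp
  have K: "p dvd c k" if "k \<in> K" for k
  proof -
    have "p dvd c k * (int k - int e)"
      using insert.IH[OF _ van that] insert.prems(1) by simp
    \<comment> \<open>Distinct exponents below p remain distinct modulo p, so the factor k - e
      introduced by the operator is invertible.\<close>
    moreover have "\<not> p dvd int k - int e"
    proof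
      assume "p dvd int k - int e"
      moreover have "\<bar>int k - int e\<bar> < p"
        using insert.prems(1)[of k] insert.prems(1)[of e] that by auto
      ultimately have "int k = int e"
        using dvd_imp_le_int[of "int k - int e" p] by auto
      then show False
        using that insert.hyps by simp
    qed
    ultimately show ?thesis
      using assms(1) prime_dvd_mult_iff by blast
  qed
  \<comment> \<open>The operator has erased \<open>c e\<close>. It is recovered from the value at 1,
    where the whole sum vanishes modulo p.\<close>
  have "poly ?H 1 = p * poly H 1"
    unfolding H_eq by simp
  moreover have "poly ?H 1 = c e + (\<Sum>k\<in>K. c k)"
    using insert.hyps by (simp add: poly_sum poly_monom)
  moreover have "p dvd (\<Sum>k\<in>K. c k)"
    using K by (rule dvd_sum)
  ultimately have "p dvd c e"
    by (metis dvd_add_left_iff dvd_triv_left)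
  with K insert.prems(3) show ?case
    by auto
qed simp

section \<open>Stepanov's method\<close>

text \<open>Modulo p the terms with c = 0 form a multiple of (X - 1)^t. They have at most A B \<le>
  t exponents, pairwise distinct (a and b are the base-t digits) and below t B \<le> p, so
  \<open>sparse_poly_vanishes_mod\<close> kills all their coefficients. Then (X - 1)^t cancels and C
  drops by one; C is kept apart from B for this induction.\<close>

lemma stepanov_basis_independent:
  fixes p :: int and lam :: "nat \<Rightarrow> nat \<Rightarrow> nat \<Rightarrow> int"
  assumes "prime p" "A * B \<le> t" "int (t * B) \<le> p"
    and "[:p:] dvd (\<Sum>c<C. [:-1, 1:] ^ (t * c) *
           (\<Sum>(a, b)\<in>{..<A} \<times> {..<B}. Polynomial.monom (lam a b c) (a + t * b)))"
    and "a < A" "b < B" "c < C"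
  shows "p dvd lam a b c"
  using assms(4,7)
proof (induction C arbitrary: lam c)
  case (Suc C)
  let ?L = "[:-1, 1:] :: int poly"
  define H where "H c = (\<Sum>(a, b)\<in>{..<A} \<times> {..<B}. Polynomial.monom (lam a b c) (a + t * b))" for c
  define T where "T = (\<Sum>c<C. ?L ^ (t * c) * H (Suc c))"
  have split: "(\<Sum>c<Suc C. ?L ^ (t * c) * H c) = H 0 + ?L ^ t * T"
    unfolding T_def sum.lessThan_Suc_shift
    by (simp only: mult_Suc_right power_add mult.assoc sum_distrib_left) simp
  have dvd: "[:p:] dvd H 0 + ?L ^ t * T"
    using Suc.prems(1) unfolding H_def[symmetric] split .
  have "A \<le> t"
    using assms(2,6) by (cases B) auto
  then have "t > 0"
    using assms(5) by linarith
  define K where "K = (\<lambda>(a, b). a + t * b) ` ({..<A} \<times> {..<B})"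
  have div_mod: "(a + t * b) mod t = a" "(a + t * b) div t = b" if "a < A" for a b
    using that \<open>A \<le> t\<close> by auto
  have inj: "inj_on (\<lambda>(a, b). a + t * b) ({..<A} \<times> {..<B})"
    by (rule inj_onI) (use div_mod in \<open>auto, metis+\<close>)
  have card_K: "card K = A * B"
    unfolding K_def by (subst card_image[OF inj]) simp
  have H0: "H 0 = (\<Sum>k\<in>K. Polynomial.monom (lam (k mod t) (k div t) 0) k)"
    unfolding K_def H_def by (subst sum.reindex[OF inj]) (use \<open>A \<le> t\<close> in \<open>auto intro!: sum.cong simp: mod_less\<close>)
  have "vanishes_mod p t 1 (H 0)"
    unfolding vanishes_mod_def using dvd by (intro exI[of _ "- T"]) simp
  then have van: "vanishes_mod p (card K) 1 (\<Sum>k\<in>K. Polynomial.monom (lam (k mod t) (k div t) 0) k)"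
    using assms(2) card_K vanishes_mod_mono H0 by simp
  have "int k < p" if k: "k \<in> K" for k
  proof -
    obtain a b where "a < A" "b < B" "k = a + t * b"
      using k unfolding K_def image_iff by fastforce
    then have "k < t * Suc b"
      using \<open>A \<le> t\<close> by simp
    also have "\<dots> \<le> t * B"
      using \<open>b < B\<close> by (intro mult_le_mono) simp_all
    finally show ?thesis
      using assms(3) by linarith
  qed
  then have K: "p dvd lam (k mod t) (k div t) 0" if "k \<in> K" for k
    using sparse_poly_vanishes_mod[OF assms(1) _ _ van] that unfolding K_def by simp
  have lam0: "p dvd lam a b 0" if "a < A" "b < B" for a b
    using K[of "a + t * b"] that div_mod unfolding K_def by force
  have "[:p:] dvd H 0"
    unfolding H0 using K by (intro dvd_sum) (simp add: const_poly_dvd_iff)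
  then have "[:p:] dvd ?L ^ t * T"
    using dvd by (simp add: dvd_add_right_iff)
  then have "[:p:] dvd T"
    using const_dvd_linear_power_mult_iff[OF assms(1)] by blast
  then have rest: "p dvd lam a b (Suc c)" if "c < C" for c
    using Suc.IH[of "\<lambda>a b c. lam a b (Suc c)" c] that unfolding T_def H_def by simp
  show ?case
    using lam0[OF assms(5,6)] rest Suc.prems(2) by (cases c) auto
qed simp

text \<open>The cofactor $P_n$ in $(X (X-1))^n \frac{d^n}{dX^n} X^m (X-1)^k = X^m (X-1)^k P_n$.\<close>

fun deriv_factor :: "nat \<Rightarrow> nat \<Rightarrow> nat \<Rightarrow> int poly" where
  "deriv_factor m k 0 = 1"
| "deriv_factor m k (Suc n) =
     (smult (int m) [:-1, 1:] + smult (int k) [:0, 1:] - smult (int n) [:-1, 2:]) * deriv_factor m k n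
     + [:0, -1, 1:] * pderiv (deriv_factor m k n)"

text \<open>The bound is independent of m and k, which are as large as t B in the application. This
  is what keeps the number of linear conditions on the auxiliary polynomial small.\<close>

lemma degree_deriv_factor: "Polynomial.degree (deriv_factor m k n) \<le> n"
proof (induction n)
  case (Suc n)
  let ?q = "deriv_factor m k n"
  have "Polynomial.degree (smult (int m) [:-1, 1:] + smult (int k) [:0, 1:] - smult (int n) [:-1, 2:]) \<le> 1"
    by (intro degree_diff_le degree_add_le order_trans[OF degree_smult_le]) auto
  then have "Polynomial.degree ((smult (int m) [:-1, 1:] + smult (int k) [:0, 1:] - smult (int n) [:-1, 2:]) * ?q) \<le> Suc n"
    using Suc by (intro order_trans[OF degree_mult_le]) simp
  moreover have "Polynomial.degree ([:0, -1, 1:] * pderiv ?q) \<le> Suc n"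
  proof (cases "pderiv ?q = 0")
    case False
    then have "Polynomial.degree ?q \<noteq> 0"
      by (simp add: pderiv_eq_0_iff)
    then have "Polynomial.degree (pderiv ?q) \<le> n - 1" "n > 0"
      using Suc by (auto simp: degree_pderiv)
    then show ?thesis
      by (intro order_trans[OF degree_mult_le]) simp
  qed simp
  ultimately show ?case
    by (simp only: deriv_factor.simps) (intro degree_add_le)
qed simp

lemma mult_pderiv_power:
  fixes L :: "int poly"
  assumes "pderiv L = 1"
  shows "L * pderiv (L ^ k) = smult (int k) (L ^ k)"
  using assms by (cases k) (simp_all add: pderiv_power_Suc del: power_Suc, simp)

lemma higher_pderiv_two_powers:
  fixes X L :: "int poly"
  defines "X \<equiv> [:0, 1:]" and "L \<equiv> [:-1, 1:]"
  shows "(X * L) ^ n * (pderiv ^^ n) (X ^ m * L ^ k) = X ^ m * L ^ k * deriv_factor m k n"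
proof (induction n)
  case (Suc n)
  define F W Q where "F = X ^ m * L ^ k" and "W = X * L"
    and "Q = smult (int m) L + smult (int k) X"
  define D where "D = (pderiv ^^ n) F"
  define P where "P = deriv_factor m k n"
  have pX: "pderiv X = 1" and pL: "pderiv L = 1"
    unfolding X_def L_def by (simp_all add: pderiv_pCons)
  have "W * pderiv F = X ^ m * X * (L * pderiv (L ^ k)) + (X * pderiv (X ^ m)) * (L * L ^ k)"
    unfolding W_def F_def by (simp add: pderiv_mult algebra_simps)
  also have "\<dots> = F * Q"
    unfolding mult_pderiv_power[OF pX] mult_pderiv_power[OF pL] F_def Q_def by (simp add: algebra_simps)
  finally have WF: "W * pderiv F = F * Q" .
  have pW: "pderiv W = [:-1, 2:]"
    unfolding W_def X_def L_def by (simp add: pderiv_pCons)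
  have IH: "W ^ n * D = F * P"
    using Suc unfolding F_def W_def D_def P_def .
  \<comment> \<open>The induction hypothesis is differentiated; the extra factor W turns the
    derivatives of \<open>F\<close> and of \<open>W ^ n\<close> back into multiples of
    \<open>F\<close> and \<open>W ^ n\<close>.\<close>
  then have "W * pderiv (W ^ n * D) = W * pderiv (F * P)"
    by simp
  also have "W * pderiv (W ^ n * D) = W ^ Suc n * pderiv D + (W * pderiv (W ^ n)) * D"
    by (simp add: pderiv_mult algebra_simps)
  also have "W * pderiv (W ^ n) = smult (int n) (W ^ n) * pderiv W"
    by (cases n) (simp_all add: pderiv_power_Suc del: power_Suc, simp add: mult.assoc)
  also have "smult (int n) (W ^ n) * pderiv W * D = smult (int n) (pderiv W) * (W ^ n * D)"
    by (simp add: mult_ac)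
  also have "W * pderiv (F * P) = W * pderiv F * P + F * (W * pderiv P)"
    by (simp add: pderiv_mult algebra_simps)
  finally have "W ^ Suc n * pderiv D = F * ((Q - smult (int n) (pderiv W)) * P + W * pderiv P)"
    unfolding IH WF by (simp add: algebra_simps)
  moreover have "deriv_factor m k (Suc n) = (Q - smult (int n) (pderiv W)) * P + W * pderiv P"
  proof -
    have "W = [:0, -1, 1:]"
      unfolding W_def X_def L_def by simp
    then show ?thesis
      unfolding pW by (simp only: deriv_factor.simps P_def Q_def X_def L_def)
  qed
  ultimately show ?case
    unfolding D_def F_def W_def by (simp only: funpow.simps o_apply)
qed simp

lemma stepanov_bound:
  fixes p :: int and U Pts :: "int set" and A B M t :: nat
  assumes "prime p" "finite U" "A * B \<le> t" "int (t * B) \<le> p" "int M \<le> p"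
    and less: "card U * M * (A + M) < A * B * B"
    and Pts: "Pts \<subseteq> {0..<p}"
      "\<And>x. x \<in> Pts \<Longrightarrow> \<not> p dvd x \<and> \<not> p dvd x - 1"
      "\<And>x. x \<in> Pts \<Longrightarrow> \<exists>u\<in>U. p dvd x ^ t - u \<and> p dvd (x - 1) ^ t - u"
  shows "M * card Pts \<le> A + 2 * t * B"
proof -
  \<comment> \<open>The auxiliary polynomial is $\sum \lambda_{abc} X^{a + tb} (X-1)^{tc}$. At a point with
    $X^t = (X-1)^t = u$ its $n$-th derivative equals, up to a unit, the value of the polynomial $N$ of
    degree less than $A + n$; the $\lambda_{abc}$ are chosen by pigeonhole so that all these $N$ vanish
    modulo $p$.\<close>
  define I where "I = {..<A} \<times> {..<B} \<times> {..<B}"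
  define J where "J = U \<times> {..<M} \<times> {..<A + M}"
  define N :: "(nat \<times> nat \<times> nat \<Rightarrow> int) \<Rightarrow> int \<Rightarrow> nat \<Rightarrow> int poly" where
    "N lam u n = (\<Sum>(a, b, c)\<in>I. smult (lam (a, b, c) * u ^ (b + c))
                  (Polynomial.monom 1 a * deriv_factor (a + t * b) (t * c) n))" for lam u n
  define \<Phi> where "\<Phi> lam = (\<lambda>(u, n, i)\<in>J. Polynomial.coeff (N lam u n) i mod p)" for lam
  have p: "p > 1"
    using assms(1) by (rule prime_gt_1_int)
  have fin: "finite I" "finite J"
    unfolding I_def J_def using assms(2) by auto
  have "\<not> inj_on \<Phi> (I \<rightarrow>\<^sub>E {0..<p})"
  proof (rule pigeonhole)
    have "\<Phi> ` (I \<rightarrow>\<^sub>E {0..<p}) \<subseteq> (J \<rightarrow>\<^sub>E {0..<p})"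
      unfolding \<Phi>_def using p by auto
    then have "card (\<Phi> ` (I \<rightarrow>\<^sub>E {0..<p})) \<le> card (J \<rightarrow>\<^sub>E {0..<p})"
      using fin by (intro card_mono finite_PiE) auto
    also have "\<dots> = nat p ^ card J"
      using fin by (simp add: card_PiE)
    also have "\<dots> < nat p ^ card I"
      using less p unfolding I_def J_def
      by (intro power_strict_increasing) (auto simp: card_cartesian_product mult.assoc)
    also have "\<dots> = card (I \<rightarrow>\<^sub>E {0..<p})"
      using fin by (simp add: card_PiE)
    finally show "card (\<Phi> ` (I \<rightarrow>\<^sub>E {0..<p})) < card (I \<rightarrow>\<^sub>E {0..<p})" .
  qed
  then obtain l1 l2 where l: "l1 \<in> I \<rightarrow>\<^sub>E {0..<p}" "l2 \<in> I \<rightarrow>\<^sub>E {0..<p}" "\<Phi> l1 = \<Phi> l2" "l1 \<noteq> l2"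
    unfolding inj_on_def by blast
  \<comment> \<open>By linearity the difference solves the homogeneous system. Since
    \<open>l1\<close> and \<open>l2\<close> take values in \<open>{0..<p}\<close> and differ, it is
    nonzero modulo p.\<close>
  define lam where "lam i = l1 i - l2 i" for i
  have N_diff: "N lam u n = N l1 u n - N l2 u n" for u n
    unfolding N_def lam_def sum_subtractf[symmetric]
    by (intro sum.cong refl) (auto simp: left_diff_distrib smult_diff_left)
  have N_dvd: "[:p:] dvd N lam u n" if "u \<in> U" "n < M" for u n
    unfolding const_poly_dvd_iff
  proof
    fix i
    show "p dvd Polynomial.coeff (N lam u n) i"
    proof (cases "i < A + M")
      case True
      then have "\<Phi> l1 (u, n, i) = \<Phi> l2 (u, n, i)" and J: "(u, n, i) \<in> J"
        using l(3) that unfolding J_def by auto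
      then have "Polynomial.coeff (N l1 u n) i mod p = Polynomial.coeff (N l2 u n) i mod p"
        unfolding \<Phi>_def by simp
      then show ?thesis
        unfolding N_diff by (simp add: mod_eq_dvd_iff)
    next
      case False
      have "Polynomial.degree (N lam u n) \<le> A + n"
        unfolding N_def
      proof (rule degree_sum_le[OF fin(1)], clarify)
        fix a b c assume "(a, b, c) \<in> I"
        then have "a < A"
          unfolding I_def by auto
        have "Polynomial.degree (Polynomial.monom 1 a * deriv_factor (a + t * b) (t * c) n) \<le> a + n"
          by (intro order_trans[OF degree_mult_le] add_mono degree_monom_le degree_deriv_factor)
        with \<open>a < A\<close> show "Polynomial.degree (smult (lam (a, b, c) * u ^ (b + c))
            (Polynomial.monom 1 a * deriv_factor (a + t * b) (t * c) n)) \<le> A + n"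
          by (intro order_trans[OF degree_smult_le]) simp
      qed
      then have "Polynomial.coeff (N lam u n) i = 0"
        using False that by (intro coeff_eq_0) simp
      then show ?thesis
        by simp
    qed
  qed
  define \<Psi> :: "int poly" where
    "\<Psi> = (\<Sum>(a, b, c)\<in>I. smult (lam (a, b, c)) ([:0, 1:] ^ (a + t * b) * [:-1, 1:] ^ (t * c)))"
  have van: "vanishes_mod p M x \<Psi>" if x: "x \<in> Pts" for x
  proof (rule vanishes_mod_if_derivs[OF assms(1) assms(5)])
    fix n assume n: "n < M"
    obtain u where u: "u \<in> U" "[x ^ t = u] (mod p)" "[(x - 1) ^ t = u] (mod p)"
      using Pts(3)[OF x] by (auto simp: cong_iff_dvd_diff)
    have "([:0, 1:] * [:-1, 1:]) ^ n * (pderiv ^^ n) \<Psi> =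
        (\<Sum>(a, b, c)\<in>I. smult (lam (a, b, c)) ([:0, 1:] ^ (a + t * b) * [:-1, 1:] ^ (t * c)
            * deriv_factor (a + t * b) (t * c) n))"
      unfolding \<Psi>_def higher_pderiv_sum sum_distrib_left
      by (intro sum.cong refl)
        (simp only: higher_pderiv_smult mult_smult_right higher_pderiv_two_powers split_beta)
    then have "poly (([:0, 1:] * [:-1, 1:]) ^ n * (pderiv ^^ n) \<Psi>) x =
        (\<Sum>(a, b, c)\<in>I. lam (a, b, c) * (x ^ (a + t * b) * (x - 1) ^ (t * c)
            * poly (deriv_factor (a + t * b) (t * c) n) x))"
      by (simp only: poly_sum) (auto intro!: sum.cong simp: poly_power split_beta)
    then have eq: "(x * (x - 1)) ^ n * poly ((pderiv ^^ n) \<Psi>) x =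
        (\<Sum>(a, b, c)\<in>I. lam (a, b, c) * (x ^ (a + t * b) * (x - 1) ^ (t * c)
            * poly (deriv_factor (a + t * b) (t * c) n) x))"
      by (simp add: poly_power)
    have N_eq: "poly (N lam u n) x = (\<Sum>(a, b, c)\<in>I. lam (a, b, c) * u ^ (b + c) *
            (x ^ a * poly (deriv_factor (a + t * b) (t * c) n) x))"
      unfolding N_def poly_sum by (intro sum.cong refl) (auto simp: poly_monom)
    have "[(x * (x - 1)) ^ n * poly ((pderiv ^^ n) \<Psi>) x = poly (N lam u n) x] (mod p)"
      unfolding eq N_eq
    proof (rule cong_sum, clarify)
      fix a b c
      have "[x ^ a * (x ^ t) ^ b * ((x - 1) ^ t) ^ c = x ^ a * u ^ b * u ^ c] (mod p)"
        by (intro cong_mult cong_pow u cong_refl)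
      then have "[x ^ (a + t * b) * (x - 1) ^ (t * c) = x ^ a * u ^ (b + c)] (mod p)"
        by (simp only: power_add power_mult mult.assoc)
      then have "[lam (a, b, c) * (x ^ (a + t * b) * (x - 1) ^ (t * c)
            * poly (deriv_factor (a + t * b) (t * c) n) x) =
          lam (a, b, c) * (x ^ a * u ^ (b + c) * poly (deriv_factor (a + t * b) (t * c) n) x)] (mod p)"
        by (intro cong_mult[OF cong_refl] cong_mult[OF _ cong_refl])
      then show "[lam (a, b, c) * (x ^ (a + t * b) * (x - 1) ^ (t * c)
            * poly (deriv_factor (a + t * b) (t * c) n) x) =
          lam (a, b, c) * u ^ (b + c) * (x ^ a * poly (deriv_factor (a + t * b) (t * c) n) x)] (mod p)"
        by (simp add: mult_ac)
    qed
    moreover have "p dvd poly (N lam u n) x"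
      by (rule const_dvd_imp_dvd_poly[OF N_dvd[OF u(1) n]])
    ultimately have "p dvd (x * (x - 1)) ^ n * poly ((pderiv ^^ n) \<Psi>) x"
      using cong_dvd_iff by blast
    moreover have "\<not> p dvd (x * (x - 1)) ^ n"
      using Pts(2)[OF x] prime_dvd_power[OF assms(1), of "x * (x - 1)" n] prime_dvd_mult_iff[OF assms(1)] by blast
    ultimately show "p dvd poly ((pderiv ^^ n) \<Psi>) x"
      using prime_dvd_mult_iff[OF assms(1)] by blast
  qed
  have deg: "Polynomial.degree \<Psi> \<le> A + 2 * t * B"
    unfolding \<Psi>_def
  proof (rule degree_sum_le[OF fin(1)], clarify)
    fix a b c assume "(a, b, c) \<in> I"
    then have "a \<le> A" "b \<le> B" "c \<le> B"
      unfolding I_def by auto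
    then have "(a + t * b) + t * c \<le> (A + t * B) + t * B"
      by (intro add_mono mult_le_mono) auto
    moreover have "Polynomial.degree ([:0, 1:] ^ (a + t * b) * [:-1, 1:] ^ (t * c) :: int poly) \<le> (a + t * b) + t * c"
      by (intro order_trans[OF degree_mult_le] add_mono) (simp_all add: degree_power_eq)
    ultimately have "Polynomial.degree ([:0, 1:] ^ (a + t * b) * [:-1, 1:] ^ (t * c) :: int poly) \<le> A + 2 * t * B"
      by linarith
    then show "Polynomial.degree (smult (lam (a, b, c)) ([:0, 1:] ^ (a + t * b) * [:-1, 1:] ^ (t * c))) \<le> A + 2 * t * B"
      by (rule order_trans[OF degree_smult_le])
  qed
  \<comment> \<open>If the bound failed, \<Psi> would have more zeros, counted with multiplicity M,
    than its degree, so it would vanish modulo p. Independence of the products would then force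
    \<open>lam\<close> to vanish modulo p.\<close>
  show ?thesis
  proof (rule ccontr)
    assume "\<not> M * card Pts \<le> A + 2 * t * B"
    then have small: "Polynomial.degree \<Psi> < M * card Pts"
      using deg by linarith
    have inj: "x = y" if "x \<in> Pts" "y \<in> Pts" "p dvd x - y" for x y
    proof -
      have "x mod p = y mod p"
        using that(3) by (simp add: mod_eq_dvd_iff)
      then show ?thesis
        using that(1,2) Pts(1) by (auto simp: subset_iff)
    qed
    have "finite Pts"
      using Pts(1) finite_subset by blast
    then have "[:p:] dvd \<Psi>"
      using vanishes_mod_degree[OF assms(1) _ inj van small] by blast
    also have "\<Psi> = (\<Sum>c<B. [:-1, 1:] ^ (t * c) *
           (\<Sum>(a, b)\<in>{..<A} \<times> {..<B}. Polynomial.monom (lam (a, b, c)) (a + t * b)))"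
    proof -
      have "\<Psi> = (\<Sum>a<A. \<Sum>b<B. \<Sum>c<B. smult (lam (a, b, c)) ([:0, 1:] ^ (a + t * b) * [:-1, 1:] ^ (t * c)))"
        unfolding \<Psi>_def I_def by (simp add: sum.cartesian_product)
      also have "\<dots> = (\<Sum>a<A. \<Sum>c<B. \<Sum>b<B. smult (lam (a, b, c)) ([:0, 1:] ^ (a + t * b) * [:-1, 1:] ^ (t * c)))"
        by (intro sum.cong refl sum.swap)
      also have "\<dots> = (\<Sum>c<B. \<Sum>a<A. \<Sum>b<B. smult (lam (a, b, c)) ([:0, 1:] ^ (a + t * b) * [:-1, 1:] ^ (t * c)))"
        by (rule sum.swap)
      also have "\<dots> = (\<Sum>c<B. [:-1, 1:] ^ (t * c) *
           (\<Sum>a<A. \<Sum>b<B. Polynomial.monom (lam (a, b, c)) (a + t * b)))"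
        unfolding sum_distrib_left
        by (intro sum.cong refl) (simp add: monom_altdef mult.commute)
      finally show ?thesis
        by (simp add: sum.cartesian_product)
    qed
    finally have dvd: "[:p:] dvd (\<Sum>c<B. [:-1, 1:] ^ (t * c) *
           (\<Sum>(a, b)\<in>{..<A} \<times> {..<B}. Polynomial.monom (lam (a, b, c)) (a + t * b)))" .
    have "l1 i = l2 i" if iI: "i \<in> I" for i
    proof -
      obtain a b c where i: "i = (a, b, c)" "a < A" "b < B" "c < B"
        using iI unfolding I_def by auto
      have "p dvd lam (a, b, c)"
        using stepanov_basis_independent[OF assms(1,3,4), of "\<lambda>a b c. lam (a, b, c)" B a b c] dvd i by simp
      then have "l1 i mod p = l2 i mod p"
        unfolding lam_def i(1) by (simp add: mod_eq_dvd_iff)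
      moreover have "l1 i \<in> {0..<p}" "l2 i \<in> {0..<p}"
        using l(1,2) that by auto
      ultimately show ?thesis
        by simp
    qed
    then have "l1 = l2"
      using l(1,2) by (intro PiE_ext)
    with l(4) show False
      by contradiction
  qed
qed

text \<open>Choice of parameters: with M = A the counting condition becomes 2 h A < B^2, and A about
  t / B turns this into B^3 > 2 h t. The least such B satisfies B^3 \<le> 16 h t, so the two size
  hypotheses say B \<le> t and t B \<le> p. The bound becomes |Pts| \<le> 1 + 4 B^2 \<le> 5 B^2, and
  32000 = 5^3 * 16^2 after cubing.\<close>

lemma stepanov_cube_bound:
  fixes p :: int and U Pts :: "int set" and h t :: nat
  assumes "prime p" "finite U" "card U = h" "h > 0" "t > 0"
    and t: "16 * h \<le> t\<^sup>2" and p: "int (16 * t ^ 4 * h) \<le> p ^ 3"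
    and Pts: "Pts \<subseteq> {0..<p}"
      "\<And>x. x \<in> Pts \<Longrightarrow> \<not> p dvd x \<and> \<not> p dvd x - 1"
      "\<And>x. x \<in> Pts \<Longrightarrow> \<exists>u\<in>U. p dvd x ^ t - u \<and> p dvd (x - 1) ^ t - u"
  shows "card Pts ^ 3 \<le> 32000 * h\<^sup>2 * t\<^sup>2"
proof -
  have p0: "p > 0"
    using assms(1) prime_gt_0_int by blast
  define B where "B = (LEAST B. 2 * h * t < B ^ 3)"
  have "2 * h * t < (2 * h * t + 1) ^ 3"
    using self_le_power[of "2 * h * t + 1" 3] by simp
  then have B3: "2 * h * t < B ^ 3"
    unfolding B_def by (rule LeastI)
  have "B > 1"
  proof (rule ccontr)
    assume "\<not> B > 1"
    then have "B ^ 3 \<le> 1"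
      by (cases B) auto
    moreover have "0 < h * t"
      using assms(4,5) by simp
    ultimately show False
      using B3 by (simp add: mult.assoc)
  qed
  have "(B - 1) ^ 3 \<le> 2 * h * t"
    using not_less_Least[of "B - 1" "\<lambda>B. 2 * h * t < B ^ 3"] \<open>B > 1\<close> unfolding B_def[symmetric] by simp
  moreover have "B ^ 3 \<le> (2 * (B - 1)) ^ 3"
    using \<open>B > 1\<close> by (intro power_mono) auto
  ultimately have B3': "B ^ 3 \<le> 16 * h * t"
    by (simp add: power_mult_distrib)
  also have "\<dots> \<le> t ^ 3"
    using mult_le_mono1[OF t, of t] by (simp add: power2_eq_square power3_eq_cube)
  finally have "B \<le> t"
    using power_mono_iff[of B t 3] by simp
  define A where "A = t div B"
  have "A > 0"
    unfolding A_def using \<open>B \<le> t\<close> \<open>B > 1\<close> by (simp add: div_greater_zero_iff)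
  have AB: "A * B \<le> t"
    unfolding A_def by simp
  have "t mod B < B"
    using \<open>B > 1\<close> by simp
  then have "t < A * B + B"
    unfolding A_def using div_mult_mod_eq[of t B] by linarith
  then have t_le: "t \<le> 2 * (A * B)"
    using \<open>A > 0\<close> by (cases A) auto
  have "int (t * B) ^ 3 = int (t ^ 3 * B ^ 3)"
    by (simp add: power_mult_distrib)
  also have "\<dots> \<le> int (t ^ 3 * (16 * h * t))"
    using B3' by (intro of_nat_mono mult_le_mono) simp_all
  also have "\<dots> = int (16 * t ^ 4 * h)"
    by (simp add: power_numeral_reduce mult_ac)
  also have "\<dots> \<le> p ^ 3"
    by (rule p)
  finally have tB: "int (t * B) \<le> p"
    using p0 by (simp add: power_mono_iff)
  have "A \<le> t * B"
    unfolding A_def using \<open>B > 1\<close> by (intro order_trans[OF div_le_dividend]) simp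
  then have A_le: "int A \<le> p"
    using tB by linarith
  have "2 * h * A * B \<le> 2 * h * t"
    using mult_le_mono2[OF AB, of "2 * h"] by (simp add: mult_ac)
  also have "\<dots> < B * B * B"
    using B3 by (simp add: power3_eq_cube)
  finally have "2 * h * A < B * B"
    by simp
  then have "A * (2 * h * A) < A * (B * B)"
    using \<open>A > 0\<close> by (intro mult_strict_left_mono)
  moreover have "A * (2 * h * A) = card U * A * (A + A)" "A * (B * B) = A * B * B"
    using assms(3) by simp_all
  ultimately have "card U * A * (A + A) < A * B * B"
    by simp
  then have "A * card Pts \<le> A + 2 * t * B"
    using stepanov_bound[OF assms(1,2) AB tB A_le _ Pts] by blast
  also have "\<dots> \<le> A + 2 * (2 * (A * B)) * B"
    using t_le by simp
  also have "\<dots> = A * (1 + 4 * B\<^sup>2)"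
    by (simp add: algebra_simps power2_eq_square)
  finally have "card Pts \<le> 1 + 4 * B\<^sup>2"
    using \<open>A > 0\<close> by (simp only: mult_le_cancel1 simp_thms)
  also have "\<dots> \<le> 5 * B\<^sup>2"
    using \<open>B > 1\<close> by simp
  finally have "card Pts ^ 3 \<le> (5 * B\<^sup>2) ^ 3"
    by (rule power_mono) simp
  also have "\<dots> = 125 * (B ^ 3)\<^sup>2"
    by (simp add: power_mult_distrib flip: power_mult)
  also have "\<dots> \<le> 125 * (16 * h * t)\<^sup>2"
    using B3' by (intro mult_le_mono power_mono) simp_all
  also have "\<dots> = 32000 * h\<^sup>2 * t\<^sup>2"
    by (simp add: power_mult_distrib)
  finally show ?thesis .
qed

section \<open>Multiplicative subgroups as sets of residues, and their differences\<close>

locale prime_field_subgroup =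
  fixes p :: int and R :: "int set"
  assumes prime: "prime p" and R_subset: "R \<subseteq> {1..<p}" and one_in: "1 \<in> R"
    and mult_closed: "\<And>a b. a \<in> R \<Longrightarrow> b \<in> R \<Longrightarrow> a * b mod p \<in> R"
begin

lemma p_gt_1: "p > 1"
  using prime by (rule prime_gt_1_int)

lemma finite_R: "finite R"
  using R_subset finite_subset by blast

lemma not_dvd_R: "a \<in> R \<Longrightarrow> \<not> p dvd a"
  using R_subset zdvd_not_zless by fastforce

lemma residue_eqI: "x \<in> {0..<p} \<Longrightarrow> y \<in> {0..<p} \<Longrightarrow> [x = y] (mod p) \<Longrightarrow> x = y"
  by (simp add: unique_euclidean_semiring_class.cong_def)

lemma residue_eqI_R: "x \<in> R \<Longrightarrow> y \<in> R \<Longrightarrow> [x = y] (mod p) \<Longrightarrow> x = y"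
  using R_subset by (intro residue_eqI) auto

lemma cong_cancel: "\<not> p dvd k \<Longrightarrow> [k * a = k * b] (mod p) \<longleftrightarrow> [a = b] (mod p)"
  using prime by (intro cong_mult_lcancel) (metis coprime_commute prime_imp_coprime)

lemma inj_mult_mod: "\<not> p dvd c \<Longrightarrow> S \<subseteq> {0..<p} \<Longrightarrow> inj_on (\<lambda>r. c * r mod p) S"
  by (rule inj_onI, rule residue_eqI)
    (auto simp: cong_cancel simp flip: unique_euclidean_semiring_class.cong_def)

text \<open>An injective self-map of a finite set is onto; this also yields the inverses in
  \<open>inverse_in_R\<close>.\<close>

lemma bij_mult_R:
  assumes "c \<in> R"
  shows "bij_betw (\<lambda>r. c * r mod p) R R"
proof -
  have inj: "inj_on (\<lambda>r. c * r mod p) R"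
    using not_dvd_R[OF assms] R_subset by (intro inj_mult_mod) auto
  moreover have "(\<lambda>r. c * r mod p) ` R \<subseteq> R"
    using assms mult_closed by auto
  ultimately show ?thesis
    unfolding bij_betw_def using endo_inj_surj finite_R by blast
qed

text \<open>As in the classical proof of Fermat's theorem: multiplication by c permutes R, so the
  product over R is unchanged when each of its factors is multiplied by c.\<close>

lemma power_card_R:
  assumes "c \<in> R"
  shows "[c ^ card R = 1] (mod p)"
proof -
  have "(\<Prod>r\<in>R. r) = (\<Prod>r\<in>R. c * r mod p)"
    using prod.reindex_bij_betw[OF bij_mult_R[OF assms], of "\<lambda>r. r"] by simp
  also have "[\<dots> = (\<Prod>r\<in>R. c * r)] (mod p)"
    by (intro cong_prod) simp
  also have "(\<Prod>r\<in>R. c * r) = (\<Prod>r\<in>R. r) * c ^ card R"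
    by (simp add: prod.distrib mult.commute)
  finally have "[(\<Prod>r\<in>R. r) * c ^ card R = (\<Prod>r\<in>R. r) * 1] (mod p)"
    by (simp add: cong_sym)
  moreover have "\<not> p dvd (\<Prod>r\<in>R. r)"
    using prime_dvd_prod_iff[OF finite_R prime] not_dvd_R by auto
  ultimately show ?thesis
    using cong_cancel by blast
qed

definition diff_count :: "int set \<Rightarrow> int \<Rightarrow> nat" where
  "diff_count A s = card {(a, b) \<in> A \<times> A. [a - b = s] (mod p)}"

abbreviation drep :: "int \<Rightarrow> nat" where "drep \<equiv> diff_count R"

text \<open>Formulated for R-invariant D because the level sets of \<open>drep\<close> are of this
  kind and because s^(-t) is constant on R-orbits, which makes the set U of values small.\<close>

lemma invariant_set_bound:
  assumes D: "D \<subseteq> {1..<p}" "\<And>s c. s \<in> D \<Longrightarrow> c \<in> R \<Longrightarrow> s * c mod p \<in> D"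
    and t: "16 \<le> card R" "card D \<le> (card R)\<^sup>2" "int (16 * card R ^ 5) \<le> p ^ 3"
  shows "(\<Sum>s\<in>D. drep s) ^ 3 \<le> 32000 * card R ^ 3 * (card D)\<^sup>2"
proof (cases "D = {}")
  case False
  define t where "t = card R"
  have finD: "finite D"
    using D(1) finite_subset by blast
  have not_dvd_D: "\<not> p dvd s" if "s \<in> D" for s
    using that D(1) zdvd_not_zless by fastforce
  have "\<exists>v. [s * v = 1] (mod p)" if "s \<in> D" for s
    using not_dvd_D[OF that] prime by (metis cong_solve_coprime_int coprime_commute prime_imp_coprime)
  then obtain iv where iv: "\<And>s. s \<in> D \<Longrightarrow> [s * iv s = 1] (mod p)"
    by metis
  define g where "g s = iv s ^ t mod p" for s
  have g: "[s ^ t * g s = 1] (mod p)" if "s \<in> D" for s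
  proof -
    have "[s ^ t * g s = s ^ t * iv s ^ t] (mod p)"
      unfolding g_def by (intro cong_mult) simp_all
    also have "s ^ t * iv s ^ t = (s * iv s) ^ t"
      by (simp add: power_mult_distrib)
    also have "[\<dots> = 1 ^ t] (mod p)"
      using iv[OF that] by (rule cong_pow)
    finally show ?thesis
      by simp
  qed
  define U where "U = g ` D"
  define h where "h = card U"
  have "h > 0"
    unfolding h_def U_def using False finD by (simp add: card_gt_0_iff)
  \<comment> \<open>Since c^t = 1 for c in R, the function g is constant on the orbit sR, so every
    fibre of g contains at least t elements of D.\<close>
  have ht: "h * t \<le> card D"
  proof -
    have "t \<le> card {s' \<in> D. g s' = u}" if "u \<in> U" for u
    proof -
      obtain s where s: "s \<in> D" "u = g s"
        using \<open>u \<in> U\<close> unfolding U_def by auto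
      have "(\<lambda>c. s * c mod p) ` R \<subseteq> {s' \<in> D. g s' = u}"
      proof clarify
        fix c assume c: "c \<in> R"
        let ?s = "s * c mod p"
        have D': "?s \<in> D"
          using D(2) s c by blast
        have "[?s ^ t = (s * c) ^ t] (mod p)"
          by (intro cong_pow) simp
        also have "(s * c) ^ t = s ^ t * c ^ t"
          by (simp add: power_mult_distrib)
        also have "[\<dots> = s ^ t * 1] (mod p)"
          using power_card_R[OF c] unfolding t_def by (intro cong_mult) simp_all
        finally have *: "[?s ^ t = s ^ t] (mod p)"
          by simp
        have "[s ^ t * g ?s = ?s ^ t * g ?s] (mod p)"
          by (rule cong_mult[OF cong_sym[OF *] cong_refl])
        also have "[?s ^ t * g ?s = 1] (mod p)"
          using g[OF D'] .
        also have "[1 = s ^ t * g s] (mod p)"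
          using g[OF s(1)] by (rule cong_sym)
        finally have "[s ^ t * g ?s = s ^ t * g s] (mod p)" .
        then have "[g ?s = g s] (mod p)"
          using not_dvd_D[OF s(1)] prime_dvd_power[OF prime] cong_cancel by blast
        then show "?s \<in> D \<and> g ?s = u"
          using D' s(2) p_gt_1 by (auto intro!: residue_eqI simp: g_def)
      qed
      moreover have "inj_on (\<lambda>c. s * c mod p) R"
        using not_dvd_D[OF s(1)] R_subset by (intro inj_mult_mod) auto
      ultimately show ?thesis
        unfolding t_def using finD by (intro card_inj_on_le) auto
    qed
    then have "(\<Sum>u\<in>U. t) \<le> (\<Sum>u\<in>U. card {s' \<in> D. g s' = u})"
      by (rule sum_mono)
    also have "\<dots> = card D"
      using sum.image_gen[OF finD, of "\<lambda>_. 1::nat" g] unfolding U_def by simp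
    finally show ?thesis
      unfolding h_def by simp
  qed
  define T where "T = (SIGMA s:D. {(a, b) \<in> R \<times> R. [a - b = s] (mod p)})"
  define f where "f = (\<lambda>(s, a, b :: int). a * iv s mod p)"
  \<comment> \<open>Dividing $a - b = s$ by $s$ yields a point $x = a/s$ with $x^t = (x-1)^t = s^{-t}$.\<close>
  define Pts where "Pts = f ` T"
  have f: "[s * f (s, a, b) = a] (mod p)" if "s \<in> D" for s a b
  proof -
    have "[s * f (s, a, b) = s * (a * iv s)] (mod p)"
      unfolding f_def by (intro cong_mult) simp_all
    also have "s * (a * iv s) = a * (s * iv s)"
      by simp
    also have "[\<dots> = a * 1] (mod p)"
      using iv[OF that] by (intro cong_mult cong_refl)
    finally show ?thesis
      by simp
  qed
  have card_T: "card T = (\<Sum>s\<in>D. drep s)"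
    unfolding T_def diff_count_def using finD finite_R
    by (subst card_SigmaI) (auto intro: finite_subset[of _ "R \<times> R"])
  \<comment> \<open>The point x = a / s together with a determines s = a / x and then b = a - s, so
    at most t triples lie over one point.\<close>
  have "inj_on (\<lambda>x. (f x, fst (snd x))) T"
  proof (rule inj_onI)
    fix x y assume xy: "x \<in> T" "y \<in> T" "(f x, fst (snd x)) = (f y, fst (snd y))"
    obtain s a b s' a' b' where x: "x = (s, a, b)" and y: "y = (s', a', b')"
      by (cases x; cases y) auto
    have T: "(s, a, b) \<in> T" "(s', a', b') \<in> T" and eq: "f (s, a, b) = f (s', a', b')" "a = a'"
      using xy unfolding x y by auto
    have a: "a' = a"
      using eq by simp
    have D: "s \<in> D" "s' \<in> D" "a \<in> R"
      using T unfolding T_def by auto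
    let ?x = "f (s, a, b)"
    have "[?x * s = a] (mod p)" "[?x * s' = a] (mod p)"
      using f[OF D(1), of a b] f[OF D(2), of a' b'] eq(1) a by (simp_all add: mult.commute)
    then have "[?x * s = ?x * s'] (mod p)"
      by (rule cong_trans[OF _ cong_sym])
    moreover have "\<not> p dvd ?x"
      using not_dvd_R[OF D(3)] cong_dvd_iff[OF \<open>[?x * s = a] (mod p)\<close>] dvd_mult2 by auto
    ultimately have "[s = s'] (mod p)"
      using cong_cancel by blast
    then have s: "s = s'"
      using D assms(1) by (intro residue_eqI) auto
    have "[a - b = s] (mod p)" "[a - b' = s] (mod p)" "b \<in> R" "b' \<in> R"
      using T a s unfolding T_def by auto
    then have "[a - (a - b) = a - (a - b')] (mod p)"
      using cong_diff[OF cong_refl cong_trans[OF \<open>[a - b = s] (mod p)\<close> cong_sym[OF \<open>[a - b' = s] (mod p)\<close>]]]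
      by blast
    then have "b = b'"
      using \<open>b \<in> R\<close> \<open>b' \<in> R\<close> by (intro residue_eqI_R) auto
    with a s show "x = y"
      unfolding x y by simp
  qed
  moreover have "(\<lambda>x. (f x, fst (snd x))) ` T \<subseteq> Pts \<times> R"
    unfolding Pts_def T_def by auto
  moreover have finT: "finite T"
    unfolding T_def using finD finite_R by (auto intro: finite_subset[of _ "R \<times> R"])
  ultimately have "card T \<le> card (Pts \<times> R)"
    unfolding Pts_def using finite_R by (intro card_inj_on_le) auto
  then have T_le: "card T \<le> card Pts * t"
    by (simp add: card_cartesian_product t_def)
  have "card Pts ^ 3 \<le> 32000 * h\<^sup>2 * t\<^sup>2"
  proof (rule stepanov_cube_bound[OF prime])
    show "finite U"
      unfolding U_def using finD by simp
    \<comment> \<open>The hypothesis on the size of D gives h \<le> t, which reduces both size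
      conditions of Stepanov's bound to conditions on t alone.\<close>
    have "h * t \<le> t * t"
      using order_trans[OF ht t(2)] unfolding t_def by (simp only: power2_eq_square)
    then have "h \<le> t"
      using t(1) unfolding t_def by simp
    show "16 * h \<le> t\<^sup>2"
      using mult_le_mono[OF t(1)[folded t_def] \<open>h \<le> t\<close>] by (simp add: power2_eq_square)
    have "16 * t ^ 4 * h \<le> 16 * t ^ 5"
      using \<open>h \<le> t\<close> by (simp add: power_numeral_reduce)
    then show "int (16 * t ^ 4 * h) \<le> p ^ 3"
      using t(3) unfolding t_def by linarith
    show "Pts \<subseteq> {0..<p}"
      unfolding Pts_def f_def using p_gt_1 by auto
  next
    fix x assume "x \<in> Pts"
    then obtain s a b where "x = f (s, a, b)" and sab: "s \<in> D" "a \<in> R" "b \<in> R" "[a - b = s] (mod p)"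
      unfolding Pts_def T_def by auto
    then have xs: "[s * x = a] (mod p)"
      using f by simp
    have "[s * (x - 1) = a - s] (mod p)"
      using cong_diff[OF xs cong_refl[of s]] by (simp add: algebra_simps)
    also have "[a - s = a - (a - b)] (mod p)"
      by (rule cong_diff[OF cong_refl cong_sym[OF sab(4)]])
    finally have xs': "[s * (x - 1) = b] (mod p)"
      by simp
    show "\<not> p dvd x \<and> \<not> p dvd x - 1"
      using not_dvd_R[OF sab(2)] not_dvd_R[OF sab(3)] cong_dvd_iff[OF xs]
        cong_dvd_iff[OF xs'] dvd_mult[of p _ s] by blast
    have pow: "[s ^ t * y ^ t = s ^ t * g s] (mod p)" if "[s * y = c] (mod p)" "c \<in> R" for y c
    proof -
      have "[(s * y) ^ t = c ^ t] (mod p)"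
        using that(1) by (rule cong_pow)
      also have "[c ^ t = 1] (mod p)"
        using power_card_R[OF that(2)] unfolding t_def .
      also have "[1 = s ^ t * g s] (mod p)"
        using g[OF sab(1)] by (rule cong_sym)
      finally show ?thesis
        by (simp add: power_mult_distrib)
    qed
    have "\<not> p dvd s ^ t"
      using not_dvd_D[OF sab(1)] prime_dvd_power[OF prime] by blast
    then have "[x ^ t = g s] (mod p)" "[(x - 1) ^ t = g s] (mod p)"
      using pow[OF xs sab(2)] pow[OF xs' sab(3)] cong_cancel by blast+
    then show "\<exists>u\<in>U. p dvd x ^ t - u \<and> p dvd (x - 1) ^ t - u"
      unfolding U_def using sab(1) by (auto simp: cong_iff_dvd_diff)
  qed (use \<open>h > 0\<close> t(1) in \<open>auto simp: h_def t_def\<close>)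
  then have "(card Pts * t) ^ 3 \<le> 32000 * h\<^sup>2 * t\<^sup>2 * t ^ 3"
    by (simp add: power_mult_distrib)
  also have "\<dots> = 32000 * t ^ 3 * (h * t)\<^sup>2"
    by (simp add: power_mult_distrib)
  also have "\<dots> \<le> 32000 * t ^ 3 * (card D)\<^sup>2"
    using ht by (intro mult_le_mono power_mono) simp_all
  finally show ?thesis
    unfolding card_T[symmetric] using power_mono[OF T_le, of 3] unfolding t_def by linarith
qed simp

end

section \<open>Popular differences and moments of the representation count\<close>

lemma harm_le_1_plus_ln:
  assumes "n > 0"
  shows "harm n \<le> 1 + ln (real n)"
  using decseqD[OF decseq_harm_diff_ln, of 0 "n - 1"] assms by (simp add: harm_def)

text \<open>Summation by levels: writing r^3 as a sum over k \<le> r converts the third moment into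
  a weighted sum of sizes of level sets.\<close>

lemma cube_le_sum_squares: "n ^ 3 \<le> (\<Sum>k\<in>{1..n}. 3 * k\<^sup>2)" for n :: nat
proof (induction n)
  case (Suc n)
  have "Suc n ^ 3 \<le> n ^ 3 + 3 * (Suc n)\<^sup>2"
    by (simp add: power2_eq_square power3_eq_cube algebra_simps)
  with Suc show ?case
    by simp
qed simp

context prime_field_subgroup
begin

lemma drep_mult:
  assumes "c \<in> R"
  shows "drep s \<le> drep (s * c mod p)"
proof -
  let ?f = "\<lambda>(a, b). (c * a mod p, c * b mod p)"
  have "inj_on (\<lambda>r. c * r mod p) R"
    using bij_mult_R[OF assms] bij_betw_def by blast
  then have "inj_on ?f (R \<times> R)"
    by (auto simp: inj_on_def)
  then have "inj_on ?f {(a, b) \<in> R \<times> R. [a - b = s] (mod p)}"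
    by (rule inj_on_subset) auto
  moreover have "?f ` {(a, b) \<in> R \<times> R. [a - b = s] (mod p)} \<subseteq> {(a, b) \<in> R \<times> R. [a - b = s * c mod p] (mod p)}"
  proof clarify
    fix a b assume ab: "a \<in> R" "b \<in> R" "[a - b = s] (mod p)"
    have "[c * a mod p - c * b mod p = c * a - c * b] (mod p)"
      by (intro cong_diff) simp_all
    moreover have "[c * (a - b) = c * s] (mod p)"
      by (rule cong_mult[OF cong_refl ab(3)])
    ultimately have "[c * a mod p - c * b mod p = s * c mod p] (mod p)"
      by (simp add: right_diff_distrib mult.commute cong_trans)
    then show "(c * a mod p, c * b mod p) \<in> R \<times> R \<and> [c * a mod p - c * b mod p = s * c mod p] (mod p)"
      using assms ab mult_closed by auto
  qed
  moreover have "finite {(a, b) \<in> R \<times> R. [a - b = s * c mod p] (mod p)}"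
    using finite_R by (auto intro: finite_subset[of _ "R \<times> R"])
  ultimately show ?thesis
    unfolding diff_count_def by (rule card_inj_on_le)
qed

lemma sum_diff_count:
  fixes f :: "int \<Rightarrow> real"
  assumes "finite A"
  shows "(\<Sum>(a, b)\<in>A \<times> A. f ((a - b) mod p)) = (\<Sum>s\<in>{0..<p}. real (diff_count A s) * f s)"
proof -
  have "(\<Sum>x\<in>A \<times> A. f ((fst x - snd x) mod p)) =
      (\<Sum>s\<in>{0..<p}. \<Sum>x\<in>{x \<in> A \<times> A. (fst x - snd x) mod p = s}. f ((fst x - snd x) mod p))"
    using assms p_gt_1 by (intro sum.group[symmetric]) auto
  also have "\<dots> = (\<Sum>s\<in>{0..<p}. real (diff_count A s) * f s)"
  proof (rule sum.cong[OF refl])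
    fix s assume s: "s \<in> {0..<p}"
    have *: "{(a, b) \<in> A \<times> A. [a - b = s] (mod p)} = {x \<in> A \<times> A. (fst x - snd x) mod p = s}"
      using s by (auto simp: unique_euclidean_semiring_class.cong_def)
    show "(\<Sum>x\<in>{x \<in> A \<times> A. (fst x - snd x) mod p = s}. f ((fst x - snd x) mod p)) =
        real (diff_count A s) * f s"
      unfolding diff_count_def * by simp
  qed
  finally show ?thesis
    by (simp add: split_beta)
qed

lemma sum_drep: "(\<Sum>s\<in>{0..<p}. drep s) = (card R)\<^sup>2"
proof -
  have "real (\<Sum>s\<in>{0..<p}. drep s) = real ((card R)\<^sup>2)"
    using sum_diff_count[OF finite_R, of "\<lambda>_. 1"] by (simp add: card_cartesian_product power2_eq_square)
  then show ?thesis
    by (simp only: of_nat_eq_iff)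
qed

lemma drep_le: "drep s \<le> card R"
proof -
  have "inj_on fst {(a, b) \<in> R \<times> R. [a - b = s] (mod p)}"
  proof (rule inj_onI, clarify)
    fix a b a' b' assume ab: "[a - b = s] (mod p)" "[a' - b' = s] (mod p)" "b \<in> R" "b' \<in> R" "fst (a, b) = fst (a', b')"
    have "[a - b = a - b'] (mod p)"
      using ab cong_trans[OF ab(1) cong_sym[OF ab(2)]] by simp
    then have "[a - (a - b) = a - (a - b')] (mod p)"
      by (rule cong_diff[OF cong_refl])
    then have "b = b'"
      using ab by (intro residue_eqI_R) auto
    then show "a = a' \<and> b = b'"
      using ab by simp
  qed
  then show ?thesis
    unfolding diff_count_def using finite_R by (intro card_inj_on_le[of fst]) auto
qed

lemma drep_0: "drep 0 = card R"
proof -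
  have "{(a, b) \<in> R \<times> R. [a - b = 0] (mod p)} = (\<lambda>a. (a, a)) ` R"
    using residue_eqI_R by (auto simp: cong_iff_dvd_diff)
  then show ?thesis
    unfolding diff_count_def by (simp add: card_image inj_on_def)
qed

text \<open>On the level set D the sum of \<open>drep\<close> is at least k |D|, so
  \<open>invariant_set_bound\<close> becomes k^3 |D|^3 \<le> 32000 t^3 |D|^2. Its hypothesis |D|
  \<le> t^2 holds because \<open>drep\<close> sums to t^2.\<close>

lemma popular_differences_bound:
  assumes "16 \<le> card R" "int (16 * card R ^ 5) \<le> p ^ 3" "k > 0"
  shows "k ^ 3 * card {s \<in> {1..<p}. k \<le> drep s} \<le> 32000 * card R ^ 3"
proof -
  define D where "D = {s \<in> {1..<p}. k \<le> drep s}"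
  have D: "D \<subseteq> {1..<p}"
    unfolding D_def by auto
  have "k * card D \<le> (\<Sum>s\<in>D. drep s)"
    using sum_mono[of D "\<lambda>_. k" drep] unfolding D_def by (simp add: mult.commute)
  also have le: "(\<Sum>s\<in>D. drep s) \<le> (\<Sum>s\<in>{0..<p}. drep s)"
    using D by (intro sum_mono2) auto
  finally have "k * card D \<le> (card R)\<^sup>2"
    by (simp add: sum_drep)
  moreover have "card D \<le> k * card D"
    using assms(3) by simp
  ultimately have card_D: "card D \<le> (card R)\<^sup>2"
    by linarith
  have "s * c mod p \<in> D" if "s \<in> D" "c \<in> R" for s c
  proof -
    have "\<not> p dvd s" "\<not> p dvd c"
      using that D not_dvd_R zdvd_not_zless by fastforce+
    then have "s * c mod p \<noteq> 0"
      using prime prime_dvd_mult_iff by blast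
    moreover have "0 \<le> s * c mod p" "s * c mod p < p"
      using p_gt_1 by auto
    moreover have "k \<le> drep (s * c mod p)"
      using drep_mult[OF that(2), of s] that(1) unfolding D_def by simp
    ultimately show ?thesis
      unfolding D_def by simp
  qed
  then have "(\<Sum>s\<in>D. drep s) ^ 3 \<le> 32000 * card R ^ 3 * (card D)\<^sup>2"
    using invariant_set_bound[OF D _ assms(1) card_D assms(2)] by blast
  moreover have "(k * card D) ^ 3 \<le> (\<Sum>s\<in>D. drep s) ^ 3"
    using \<open>k * card D \<le> (\<Sum>s\<in>D. drep s)\<close> by (rule power_mono) simp
  ultimately have "(k * card D) ^ 3 \<le> 32000 * card R ^ 3 * (card D)\<^sup>2"
    by linarith
  then have "(k ^ 3 * card D) * (card D)\<^sup>2 \<le> 32000 * card R ^ 3 * (card D)\<^sup>2"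
    by (simp add: power_mult_distrib power2_eq_square power3_eq_cube mult_ac)
  then show ?thesis
    unfolding D_def[symmetric] by (cases "card D = 0") simp_all
qed

definition energy2 :: real where "energy2 = (\<Sum>s\<in>{0..<p}. real (drep s) ^ 2)"

definition energy3 :: real where "energy3 = (\<Sum>s\<in>{0..<p}. real (drep s) ^ 3)"

lemma atLeastLessThan_insert_0: "{0..<p} = insert 0 {1..<p}"
  using p_gt_1 by auto

text \<open>The weights 3 k^2 meet level sets of size at most 32000 t^3 / k^3, leaving 96000 t^3
  times a harmonic sum. The difference s = 0, excluded from the level sets, adds t^3, hence
  96001.\<close>

lemma energy3_bound:
  assumes "16 \<le> card R" "int (16 * card R ^ 5) \<le> p ^ 3"
  shows "energy3 \<le> 96001 * real (card R) ^ 3 * (1 + ln (real (card R)))"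
proof -
  define t where "t = card R"
  have t: "t > 0"
    using assms(1) t_def by simp
  have "(\<Sum>s\<in>{1..<p}. real (drep s) ^ 3) \<le> (\<Sum>s\<in>{1..<p}. \<Sum>k\<in>{1..t}. if k \<le> drep s then 3 * real k ^ 2 else 0)"
  proof (rule sum_mono)
    fix s
    have "real (drep s ^ 3) \<le> real (\<Sum>k\<in>{1..drep s}. 3 * k\<^sup>2)"
      by (intro of_nat_mono cube_le_sum_squares)
    also have "\<dots> = (\<Sum>k\<in>{1..drep s}. 3 * real k ^ 2)"
      by simp
    also have "\<dots> = (\<Sum>k\<in>{k \<in> {1..t}. k \<le> drep s}. 3 * real k ^ 2)"
      using drep_le[of s] by (intro sum.cong) (auto simp: t_def)
    also have "\<dots> = (\<Sum>k\<in>{1..t}. if k \<le> drep s then 3 * real k ^ 2 else 0)"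
      by (rule sum.inter_filter) simp
    finally show "real (drep s) ^ 3 \<le> (\<Sum>k\<in>{1..t}. if k \<le> drep s then 3 * real k ^ 2 else 0)"
      by simp
  qed
  also have "\<dots> = (\<Sum>k\<in>{1..t}. \<Sum>s\<in>{1..<p}. if k \<le> drep s then 3 * real k ^ 2 else 0)"
    by (rule sum.swap)
  also have "\<dots> = (\<Sum>k\<in>{1..t}. 3 * real k ^ 2 * real (card {s \<in> {1..<p}. k \<le> drep s}))"
    by (intro sum.cong refl, subst sum.inter_filter[symmetric]) (simp_all add: mult.commute)
  also have "\<dots> \<le> (\<Sum>k\<in>{1..t}. 96000 * real t ^ 3 * inverse (real k))"
  proof (rule sum_mono)
    fix k assume k: "k \<in> {1..t}"
    have "real (k ^ 3 * card {s \<in> {1..<p}. k \<le> drep s}) \<le> real (32000 * t ^ 3)"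
      using popular_differences_bound[OF assms, of k] k unfolding t_def by (intro of_nat_mono) simp
    then have "real k ^ 3 * real (card {s \<in> {1..<p}. k \<le> drep s}) \<le> 32000 * real t ^ 3"
      by simp
    then show "3 * real k ^ 2 * real (card {s \<in> {1..<p}. k \<le> drep s}) \<le> 96000 * real t ^ 3 * inverse (real k)"
      using k by (simp add: field_simps power2_eq_square power3_eq_cube)
  qed
  also have "\<dots> = 96000 * real t ^ 3 * harm t"
    by (simp add: harm_def sum_distrib_left)
  also have "\<dots> \<le> 96000 * real t ^ 3 * (1 + ln (real t))"
    using harm_le_1_plus_ln[of t] t by (intro mult_left_mono) simp_all
  finally have "(\<Sum>s\<in>{1..<p}. real (drep s) ^ 3) \<le> 96000 * real t ^ 3 * (1 + ln (real t))" .
  moreover have "energy3 = real t ^ 3 + (\<Sum>s\<in>{1..<p}. real (drep s) ^ 3)"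
    unfolding energy3_def atLeastLessThan_insert_0 by (simp add: drep_0 t_def)
  moreover have "real t ^ 3 \<le> real t ^ 3 * (1 + ln (real t))"
    using t by simp
  ultimately show ?thesis
    unfolding t_def by (simp add: algebra_simps)
qed

text \<open>Cauchy-Schwarz for the splitting r^2 = r^(1/2) r^(3/2) interpolates between the first
  moment t^2 and the third.\<close>

lemma energy2_sq_le: "energy2\<^sup>2 \<le> (real (card R))\<^sup>2 * energy3"
proof -
  have "(\<Sum>s\<in>{0..<p}. sqrt (real (drep s)) * (sqrt (real (drep s)) * real (drep s)))\<^sup>2 \<le>
     (\<Sum>s\<in>{0..<p}. (sqrt (real (drep s)))\<^sup>2) * (\<Sum>s\<in>{0..<p}. (sqrt (real (drep s)) * real (drep s))\<^sup>2)"
    by (rule Cauchy_Schwarz_ineq_sum)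
  also have "(\<Sum>s\<in>{0..<p}. (sqrt (real (drep s)))\<^sup>2) = real (\<Sum>s\<in>{0..<p}. drep s)"
    by simp
  also have "\<dots> = (real (card R))\<^sup>2"
    unfolding sum_drep by simp
  also have "(\<Sum>s\<in>{0..<p}. (sqrt (real (drep s)) * real (drep s))\<^sup>2) = energy3"
    unfolding energy3_def by (simp add: power_mult_distrib) (simp add: power2_eq_square power3_eq_cube mult.assoc)
  also have "(\<Sum>s\<in>{0..<p}. sqrt (real (drep s)) * (sqrt (real (drep s)) * real (drep s))) = energy2"
    unfolding energy2_def by (simp add: power2_eq_square flip: mult.assoc)
  finally show ?thesis .
qed

end

section \<open>Fourier analysis modulo $p$\<close>

context prime_field_subgroup
begin

definition e :: "int \<Rightarrow> complex" where "e x = cis (2 * pi * of_int x / of_int p)"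

lemma e_0 [simp]: "e 0 = 1"
  by (simp add: e_def)

lemma e_add: "e (x + y) = e x * e y"
  by (simp add: e_def cis_mult ring_distribs add_divide_distrib)

lemma e_minus: "e (- x) = cnj (e x)"
  by (simp add: e_def cis_cnj)

lemma e_multiple: "e (p * k) = 1"
proof -
  have "2 * pi * real_of_int (p * k) / real_of_int p = 2 * pi * of_int k"
    using p_gt_1 by simp
  then show ?thesis
    unfolding e_def by (simp only: cis_multiple_2pi Ints_of_int)
qed

lemma e_cong:
  assumes "[x = y] (mod p)"
  shows "e x = e y"
proof -
  obtain k where "x = y + p * k"
    using assms by (metis cong_iff_lin cong_sym mult.commute)
  then show ?thesis
    by (simp add: e_add e_multiple)
qed

lemma e_ne_1:
  assumes "\<not> p dvd x"
  shows "e x \<noteq> 1"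
proof
  assume "e x = 1"
  then have "cos (2 * pi * of_int x / of_int p) = 1"
    unfolding e_def by (simp add: complex_eq_iff)
  then obtain k :: int where "2 * pi * of_int x / of_int p = of_int k * 2 * pi"
    using cos_one_2pi_int by blast
  then have "real_of_int x = of_int (k * p)"
    using p_gt_1 by (simp add: field_simps)
  then have "x = k * p"
    by (simp only: of_int_eq_iff)
  with assms show False
    by simp
qed

lemma sum_e: "(\<Sum>\<xi>\<in>{0..<p}. e (\<xi> * x)) = (if p dvd x then of_int p else 0)"
proof (cases "p dvd x")
  case True
  then obtain k where "x = p * k"
    by blast
  then have "e (\<xi> * x) = 1" for \<xi>
    using e_multiple[of "\<xi> * k"] by (simp add: mult_ac)
  then show ?thesis
    using True p_gt_1 by (simp add: of_nat_nat)
next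
  case False
  let ?s = "\<Sum>\<xi>\<in>{0..<p}. e (\<xi> * x)"
  \<comment> \<open>Shifting \<xi> by one permutes the residues and multiplies the sum by
    \<open>e x\<close>, which is not 1.\<close>
  have "bij_betw (\<lambda>\<xi>. (\<xi> + 1) mod p) {0..<p} {0..<p}"
  proof -
    have "inj_on (\<lambda>\<xi>. (\<xi> + 1) mod p) {0..<p}"
    proof (rule inj_onI, rule residue_eqI)
      fix x y assume "(x + 1) mod p = (y + 1) mod p"
      then have "[x + 1 = y + 1] (mod p)"
        by (simp add: unique_euclidean_semiring_class.cong_def)
      then show "[x = y] (mod p)"
        by (simp add: cong_add_rcancel)
    qed
    moreover have "(\<lambda>\<xi>. (\<xi> + 1) mod p) ` {0..<p} \<subseteq> {0..<p}"
      using p_gt_1 by auto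
    ultimately show ?thesis
      unfolding bij_betw_def using endo_inj_surj by blast
  qed
  then have "?s = (\<Sum>\<xi>\<in>{0..<p}. e ((\<xi> + 1) mod p * x))"
    by (rule sum.reindex_bij_betw[symmetric])
  also have "\<dots> = (\<Sum>\<xi>\<in>{0..<p}. e x * e (\<xi> * x))"
  proof (rule sum.cong[OF refl])
    fix \<xi>
    have "e ((\<xi> + 1) mod p * x) = e ((\<xi> + 1) * x)"
      by (intro e_cong cong_mult) simp_all
    then show "e ((\<xi> + 1) mod p * x) = e x * e (\<xi> * x)"
      by (simp add: ring_distribs e_add mult.commute)
  qed
  also have "\<dots> = e x * ?s"
    by (simp add: sum_distrib_left)
  finally have "(e x - 1) * ?s = 0"
    by (simp add: algebra_simps)
  then show ?thesis
    using False e_ne_1 by simp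
qed

definition FT :: "int set \<Rightarrow> int \<Rightarrow> complex" where "FT A \<xi> = (\<Sum>a\<in>A. e (\<xi> * a))"

lemma FT_cong: "[\<xi> = \<eta>] (mod p) \<Longrightarrow> FT A \<xi> = FT A \<eta>"
  unfolding FT_def by (intro sum.cong refl e_cong cong_mult) auto

lemma FT_mod [simp]: "FT A (\<xi> mod p) = FT A \<xi>"
  by (rule FT_cong) simp

lemma FT_mult_mod [simp]: "FT A (\<xi> * (x mod p)) = FT A (\<xi> * x)"
  by (intro FT_cong cong_mult) simp_all

lemma FT_0: "FT A 0 = of_nat (card A)"
  by (simp add: FT_def)

lemma sum_e_mult:
  "(\<Sum>i\<in>I. e (\<xi> * f i)) * (\<Sum>j\<in>J. e (\<xi> * g j)) = (\<Sum>(i, j)\<in>I \<times> J. e (\<xi> * (f i + g j)))"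
  by (simp add: sum_product sum.cartesian_product ring_distribs e_add)

lemma cnj_FT: "cnj (FT A \<xi>) = (\<Sum>a\<in>A. e (\<xi> * (- a)))"
  by (simp add: FT_def flip: e_minus)

lemma norm_FT_sq: "complex_of_real ((norm (FT A \<xi>))\<^sup>2) = (\<Sum>(a, b)\<in>A \<times> A. e (\<xi> * (a - b)))"
  unfolding complex_norm_square cnj_FT using sum_e_mult[of \<xi> "\<lambda>a. a" A "\<lambda>a. - a" A]
  by (simp add: FT_def)

text \<open>Weights rather than sets, because besides indicator functions it is applied to
  \<open>drep\<close>.\<close>

lemma plancherel:
  fixes f :: "int \<Rightarrow> real"
  shows "(\<Sum>\<xi>\<in>{0..<p}. (norm (\<Sum>s\<in>{0..<p}. of_real (f s) * e (\<xi> * s)))\<^sup>2) = of_int p * (\<Sum>s\<in>{0..<p}. (f s)\<^sup>2)"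
proof -
  have sq: "complex_of_real ((norm (\<Sum>s\<in>{0..<p}. of_real (f s) * e (\<xi> * s)))\<^sup>2) =
      (\<Sum>s\<in>{0..<p}. \<Sum>s'\<in>{0..<p}. of_real (f s * f s') * e (\<xi> * (s - s')))" for \<xi>
  proof -
    have *: "e (\<xi> * s) * cnj (e (\<xi> * s')) = e (\<xi> * (s - s'))" for s s'
      using e_add[of "\<xi> * s" "- (\<xi> * s')"] by (simp add: e_minus right_diff_distrib)
    show ?thesis
      unfolding complex_norm_square cnj_sum sum_product
      by (intro sum.cong refl) (simp add: *[symmetric])
  qed
  have "complex_of_real (\<Sum>\<xi>\<in>{0..<p}. (norm (\<Sum>s\<in>{0..<p}. of_real (f s) * e (\<xi> * s)))\<^sup>2) =
     (\<Sum>\<xi>\<in>{0..<p}. \<Sum>s\<in>{0..<p}. \<Sum>s'\<in>{0..<p}. of_real (f s * f s') * e (\<xi> * (s - s')))"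
    unfolding of_real_sum sq ..
  also have "\<dots> = (\<Sum>s\<in>{0..<p}. \<Sum>\<xi>\<in>{0..<p}. \<Sum>s'\<in>{0..<p}. of_real (f s * f s') * e (\<xi> * (s - s')))"
    by (rule sum.swap)
  also have "\<dots> = (\<Sum>s\<in>{0..<p}. \<Sum>s'\<in>{0..<p}. \<Sum>\<xi>\<in>{0..<p}. of_real (f s * f s') * e (\<xi> * (s - s')))"
    by (intro sum.cong refl sum.swap)
  also have "\<dots> = (\<Sum>s\<in>{0..<p}. \<Sum>s'\<in>{0..<p}. if s' = s then of_int p * of_real ((f s)\<^sup>2) else 0)"
  proof (intro sum.cong refl)
    fix s s' assume ss: "s \<in> {0..<p}" "s' \<in> {0..<p}"
    have "p dvd s - s' \<longleftrightarrow> s' = s"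
      using residue_eqI[OF ss] by (auto simp: cong_iff_dvd_diff)
    then show "(\<Sum>\<xi>\<in>{0..<p}. of_real (f s * f s') * e (\<xi> * (s - s'))) =
        (if s' = s then of_int p * of_real ((f s)\<^sup>2) else 0 :: complex)"
      unfolding sum_distrib_left[symmetric] sum_e by (simp add: power2_eq_square mult.commute)
  qed
  also have "\<dots> = complex_of_real (of_int p * (\<Sum>s\<in>{0..<p}. (f s)\<^sup>2))"
    by (simp add: sum_distrib_left)
  finally show ?thesis
    by (simp only: of_real_eq_iff)
qed

lemma parseval:
  assumes "A \<subseteq> {0..<p}"
  shows "(\<Sum>\<xi>\<in>{0..<p}. (norm (FT A \<xi>))\<^sup>2) = of_int p * real (card A)"
proof -
  have "FT A \<xi> = (\<Sum>s\<in>{0..<p}. of_real (if s \<in> A then 1 else 0) * e (\<xi> * s))" for \<xi>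
  proof -
    have "(\<Sum>s\<in>{0..<p}. of_real (if s \<in> A then 1 else 0) * e (\<xi> * s)) =
        (\<Sum>s\<in>{0..<p}. if s \<in> A then e (\<xi> * s) else 0)"
      by (intro sum.cong) auto
    also have "\<dots> = (\<Sum>s\<in>{s \<in> {0..<p}. s \<in> A}. e (\<xi> * s))"
      by (rule sum.inter_filter[symmetric]) simp
    also have "{s \<in> {0..<p}. s \<in> A} = A"
      using assms by auto
    finally show ?thesis
      unfolding FT_def by simp
  qed
  then have "(\<Sum>\<xi>\<in>{0..<p}. (norm (FT A \<xi>))\<^sup>2) = of_int p * (\<Sum>s\<in>{0..<p}. (if s \<in> A then 1 else 0 :: real)\<^sup>2)"
    using plancherel[of "\<lambda>s. if s \<in> A then 1 else 0"] by simp
  also have "(\<Sum>s\<in>{0..<p}. (if s \<in> A then 1 else 0 :: real)\<^sup>2) = (\<Sum>s\<in>{0..<p}. if s \<in> A then 1 else 0)"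
    by (intro sum.cong) auto
  also have "\<dots> = (\<Sum>s\<in>{s \<in> {0..<p}. s \<in> A}. 1)"
    by (rule sum.inter_filter[symmetric]) simp
  also have "{s \<in> {0..<p}. s \<in> A} = A"
    using assms by auto
  finally show ?thesis
    by simp
qed

lemma norm_FT_sq_diff_count:
  assumes "finite A"
  shows "complex_of_real ((norm (FT A \<xi>))\<^sup>2) = (\<Sum>s\<in>{0..<p}. of_real (real (diff_count A s)) * e (\<xi> * s))"
proof -
  have "complex_of_real ((norm (FT A \<xi>))\<^sup>2) = (\<Sum>x\<in>A \<times> A. e (\<xi> * (fst x - snd x)))"
    unfolding norm_FT_sq by (simp add: split_beta)
  also have "\<dots> = (\<Sum>s\<in>{0..<p}. \<Sum>x\<in>{x \<in> A \<times> A. (fst x - snd x) mod p = s}. e (\<xi> * (fst x - snd x)))"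
    using assms p_gt_1 by (intro sum.group[symmetric]) auto
  also have "\<dots> = (\<Sum>s\<in>{0..<p}. of_real (real (diff_count A s)) * e (\<xi> * s))"
  proof (rule sum.cong[OF refl])
    fix s assume s: "s \<in> {0..<p}"
    have *: "{(a, b) \<in> A \<times> A. [a - b = s] (mod p)} = {x \<in> A \<times> A. (fst x - snd x) mod p = s}"
      using s by (auto simp: unique_euclidean_semiring_class.cong_def)
    have "(\<Sum>x\<in>{x \<in> A \<times> A. (fst x - snd x) mod p = s}. e (\<xi> * (fst x - snd x))) =
        (\<Sum>x\<in>{x \<in> A \<times> A. (fst x - snd x) mod p = s}. e (\<xi> * s))"
      using s by (intro sum.cong refl e_cong cong_mult) (auto simp: unique_euclidean_semiring_class.cong_def)
    then show "(\<Sum>x\<in>{x \<in> A \<times> A. (fst x - snd x) mod p = s}. e (\<xi> * (fst x - snd x))) =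
        of_real (real (diff_count A s)) * e (\<xi> * s)"
      unfolding diff_count_def * by simp
  qed
  finally show ?thesis .
qed

text \<open>The squared modulus of the transform of R is itself the transform of
  \<open>drep\<close>, so Plancherel applies to \<open>drep\<close>.\<close>

lemma fourth_moment: "(\<Sum>\<xi>\<in>{0..<p}. norm (FT R \<xi>) ^ 4) = of_int p * energy2"
proof -
  have "norm (FT R \<xi>) ^ 4 = (norm (\<Sum>s\<in>{0..<p}. of_real (real (drep s)) * e (\<xi> * s)))\<^sup>2" for \<xi>
    unfolding norm_FT_sq_diff_count[OF finite_R, symmetric] norm_of_real by (simp flip: power_mult)
  then show ?thesis
    unfolding energy2_def using plancherel[of "\<lambda>s. real (drep s)"] by simp
qed

section \<open>Fourier transforms of sets invariant under R\<close>

definition invariant :: "int set \<Rightarrow> bool" where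
  "invariant A \<longleftrightarrow> A \<subseteq> {0..<p} \<and> (\<forall>c\<in>R. \<forall>a\<in>A. c * a mod p \<in> A)"

lemma invariant_R: "invariant R"
  unfolding invariant_def using R_subset mult_closed by auto

lemma FT_invariant:
  assumes "invariant A" "c \<in> R"
  shows "FT A (\<xi> * c) = FT A \<xi>"
proof -
  have A: "A \<subseteq> {0..<p}" "finite A"
    using assms(1) finite_subset unfolding invariant_def by auto
  have "bij_betw (\<lambda>a. c * a mod p) A A"
    unfolding bij_betw_def
  proof
    show inj: "inj_on (\<lambda>a. c * a mod p) A"
      using inj_mult_mod[OF not_dvd_R[OF assms(2)] A(1)] .
    have "(\<lambda>a. c * a mod p) ` A \<subseteq> A"
      using assms unfolding invariant_def by auto
    then show "(\<lambda>a. c * a mod p) ` A = A"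
      using endo_inj_surj[OF A(2) _ inj] by blast
  qed
  then have "FT A \<xi> = (\<Sum>a\<in>A. e (\<xi> * (c * a mod p)))"
    unfolding FT_def by (rule sum.reindex_bij_betw[symmetric])
  also have "\<dots> = (\<Sum>a\<in>A. e (\<xi> * c * a))"
    by (intro sum.cong refl e_cong) (simp add: mult.assoc cong_mult)
  finally show ?thesis
    unfolding FT_def by simp
qed

text \<open>F is constant on the orbit of \<xi> under R, which consists of \<open>card R\<close>
  distinct residues because \<xi> is invertible. This is the source of the factor t gained over a
  plain moment bound.\<close>

lemma orbit_sum_le:
  fixes F :: "int \<Rightarrow> real"
  assumes "\<And>\<xi>. F \<xi> \<ge> 0" "\<And>\<xi>. F (\<xi> mod p) = F \<xi>" "\<And>\<xi> c. c \<in> R \<Longrightarrow> F (\<xi> * c) = F \<xi>" "\<not> p dvd \<xi>"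
  shows "real (card R) * F \<xi> \<le> (\<Sum>\<eta>\<in>{0..<p}. F \<eta>)"
proof -
  have inj: "inj_on (\<lambda>c. \<xi> * c mod p) R"
    using assms(4) R_subset by (intro inj_mult_mod) auto
  have "real (card R) * F \<xi> = (\<Sum>c\<in>R. F (\<xi> * c mod p))"
    using assms(2,3) by simp
  also have "\<dots> = (\<Sum>\<eta>\<in>(\<lambda>c. \<xi> * c mod p) ` R. F \<eta>)"
    by (subst sum.reindex[OF inj]) simp
  also have "\<dots> \<le> (\<Sum>\<eta>\<in>{0..<p}. F \<eta>)"
    using assms(1) p_gt_1 by (intro sum_mono2) auto
  finally show ?thesis .
qed

lemma FT_invariant_bound:
  assumes "invariant A" "\<not> p dvd \<xi>"
  shows "real (card R) * (norm (FT A \<xi>))\<^sup>2 \<le> of_int p * real (card A)"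
proof -
  have "real (card R) * (norm (FT A \<xi>))\<^sup>2 \<le> (\<Sum>\<eta>\<in>{0..<p}. (norm (FT A \<eta>))\<^sup>2)"
    using assms by (intro orbit_sum_le) (auto simp: FT_invariant)
  then show ?thesis
    using parseval assms(1) unfolding invariant_def by simp
qed

lemma FT_R_fourth_bound:
  assumes "\<not> p dvd \<xi>"
  shows "real (card R) * norm (FT R \<xi>) ^ 4 \<le> of_int p * energy2"
  unfolding fourth_moment[symmetric]
  using assms by (intro orbit_sum_le) (auto simp: FT_invariant invariant_R)

text \<open>Both sides are the sum of \<open>e (\<xi> * (x - y) * (a - b))\<close> over x, y in A
  and a, b in B.\<close>

lemma FT_duality:
  "(\<Sum>(x, y)\<in>A \<times> A. (norm (FT B (\<xi> * (x - y))))\<^sup>2) = (\<Sum>(a, b)\<in>B \<times> B. (norm (FT A (\<xi> * (a - b))))\<^sup>2)"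
proof -
  have "complex_of_real (\<Sum>(x, y)\<in>A \<times> A. (norm (FT B (\<xi> * (x - y))))\<^sup>2) =
      (\<Sum>u\<in>A \<times> A. \<Sum>v\<in>B \<times> B. e (\<xi> * (fst u - snd u) * (fst v - snd v)))"
    unfolding of_real_sum split_beta norm_FT_sq by (simp add: split_beta)
  also have "\<dots> = (\<Sum>v\<in>B \<times> B. \<Sum>u\<in>A \<times> A. e (\<xi> * (fst u - snd u) * (fst v - snd v)))"
    by (rule sum.swap)
  also have "\<dots> = (\<Sum>v\<in>B \<times> B. \<Sum>u\<in>A \<times> A. e (\<xi> * (fst v - snd v) * (fst u - snd u)))"
    by (intro sum.cong refl arg_cong[of _ _ e]) simp
  also have "\<dots> = complex_of_real (\<Sum>(a, b)\<in>B \<times> B. (norm (FT A (\<xi> * (a - b))))\<^sup>2)"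
    unfolding of_real_sum split_beta norm_FT_sq by (simp add: split_beta)
  finally show ?thesis
    by (simp only: of_real_eq_iff)
qed

end

section \<open>Sums of two elements of the subgroup\<close>

text \<open>Cauchy-Schwarz for the fibre sizes of g: they sum to |I|, and their squares sum to the
  number of collisions.\<close>

lemma card_sq_le_image_collisions:
  assumes "finite I"
  shows "(card I)\<^sup>2 \<le> card (g ` I) * card {(i, j) \<in> I \<times> I. g i = g j}"
proof -
  define n where "n y = card {i \<in> I. g i = y}" for y
  have "card I = (\<Sum>y\<in>g ` I. n y)"
    using sum.image_gen[OF assms, of "\<lambda>_. 1::nat" g] unfolding n_def by simp
  moreover have "card {(i, j) \<in> I \<times> I. g i = g j} = (\<Sum>y\<in>g ` I. (n y)\<^sup>2)"
  proof -
    have "{(i, j) \<in> I \<times> I. g i = g j} = (\<Union>y\<in>g ` I. {i \<in> I. g i = y} \<times> {i \<in> I. g i = y})"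
      by auto
    also have "card \<dots> = (\<Sum>y\<in>g ` I. card ({i \<in> I. g i = y} \<times> {i \<in> I. g i = y}))"
      using assms by (intro card_UN_disjoint) auto
    finally show ?thesis
      unfolding n_def by (simp add: card_cartesian_product power2_eq_square)
  qed
  moreover have "(\<Sum>y\<in>g ` I. real (n y) * 1)\<^sup>2 \<le> (\<Sum>y\<in>g ` I. (real (n y))\<^sup>2) * (\<Sum>y\<in>g ` I. 1\<^sup>2)"
    by (rule Cauchy_Schwarz_ineq_sum)
  then have "real ((\<Sum>y\<in>g ` I. n y)\<^sup>2) \<le> real (card (g ` I) * (\<Sum>y\<in>g ` I. (n y)\<^sup>2))"
    by (simp add: mult.commute)
  then have "(\<Sum>y\<in>g ` I. n y)\<^sup>2 \<le> card (g ` I) * (\<Sum>y\<in>g ` I. (n y)\<^sup>2)"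
    by (simp only: of_nat_le_iff)
  ultimately show ?thesis
    by simp
qed

context prime_field_subgroup
begin

definition RR :: "int set" where "RR = (\<lambda>(a, b). (a + b) mod p) ` (R \<times> R)"

lemma RR_subset: "RR \<subseteq> {0..<p}"
  unfolding RR_def using p_gt_1 by auto

lemma finite_RR: "finite RR"
  using RR_subset finite_subset by blast

lemma invariant_RR: "invariant RR"
  unfolding invariant_def
proof (intro conjI ballI RR_subset)
  fix c x assume c: "c \<in> R" and "x \<in> RR"
  then obtain a b where ab: "a \<in> R" "b \<in> R" "x = (a + b) mod p"
    unfolding RR_def by auto
  have "c * x mod p = (c * a mod p + c * b mod p) mod p"
    unfolding ab(3) by (simp add: mod_simps distrib_left)
  then show "c * x mod p \<in> RR"
    unfolding RR_def using mult_closed c ab by (auto intro!: image_eqI[of _ _ "(c * a mod p, c * b mod p)"])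
qed

abbreviation diff_pairs :: "int \<Rightarrow> (int \<times> int) set" where
  "diff_pairs s \<equiv> {(a, b) \<in> R \<times> R. [a - b = s] (mod p)}"

lemma finite_diff_pairs: "finite (diff_pairs s)"
  using finite_R by (auto intro: finite_subset[of _ "R \<times> R"])

text \<open>A collision a + b = c + d is rearranged into a - c = d - b, a pair of representations of
  one difference; such pairs are counted by \<open>energy2\<close>.\<close>

lemma card_R_le_RR: "real (card R) ^ 4 \<le> real (card RR) * energy2"
proof -
  let ?g = "\<lambda>(a, b). (a + b) mod p"
  let ?C = "{(i, j) \<in> (R \<times> R) \<times> (R \<times> R). ?g i = ?g j}"
  let ?T = "SIGMA s:{0..<p}. diff_pairs s \<times> diff_pairs s"
  let ?f = "\<lambda>((a, b), (c, d)). ((a - c) mod p, (a, c), (d, b))"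
  have "inj_on ?f ?C"
    by (auto simp: inj_on_def)
  moreover have "?f ` ?C \<subseteq> ?T"
  proof (rule image_subsetI)
    fix x assume "x \<in> ?C"
    then obtain a b c d where x: "x = ((a, b), (c, d))" and R: "a \<in> R" "b \<in> R" "c \<in> R" "d \<in> R"
      and "(a + b) mod p = (c + d) mod p"
      by auto
    then have "[a + b = c + d] (mod p)"
      by (simp add: unique_euclidean_semiring_class.cong_def)
    then have "[a + b - (b + c) = c + d - (b + c)] (mod p)"
      by (rule cong_diff) simp
    then have "[d - b = a - c] (mod p)"
      by (simp add: cong_sym)
    then show "?f x \<in> ?T"
      using R p_gt_1 unfolding x by simp
  qed
  moreover have "finite ?T"
    using finite_diff_pairs by auto
  ultimately have "card ?C \<le> card ?T"
    by (rule card_inj_on_le)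
  also have "card ?T = (\<Sum>s\<in>{0..<p}. drep s * drep s)"
    unfolding diff_count_def using finite_diff_pairs
    by (subst card_SigmaI) (auto simp: card_cartesian_product)
  finally have C: "card ?C \<le> (\<Sum>s\<in>{0..<p}. drep s * drep s)" .
  have "(card (R \<times> R))\<^sup>2 \<le> card RR * card ?C"
    unfolding RR_def using finite_R by (intro card_sq_le_image_collisions) simp
  also have "\<dots> \<le> card RR * (\<Sum>s\<in>{0..<p}. drep s * drep s)"
    using C by simp
  finally have "real ((card (R \<times> R))\<^sup>2) \<le> real (card RR * (\<Sum>s\<in>{0..<p}. drep s * drep s))"
    by (simp only: of_nat_le_iff)
  moreover have "real ((card (R \<times> R))\<^sup>2) = real (card R) ^ 4"
    by (simp add: card_cartesian_product power_mult_distrib power2_eq_square power_numeral_reduce)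
  moreover have "real (card RR * (\<Sum>s\<in>{0..<p}. drep s * drep s)) = real (card RR) * energy2"
    unfolding energy2_def by (simp add: power2_eq_square)
  ultimately show ?thesis
    by (simp only:)
qed

section \<open>The Katz-Koester inequality\<close>

definition translate_part :: "int \<Rightarrow> int set" where
  "translate_part s = {c \<in> R. (c - s) mod p \<in> R}"

text \<open>The mixed additive energy of R and \<open>translate_part s\<close>; it measures how far
  their sumset falls short of the full size \<open>card R * drep s\<close>.\<close>

definition collisions :: "int \<Rightarrow> nat" where
  "collisions s = card {((a, c), (a', c')) \<in> (R \<times> translate_part s) \<times> (R \<times> translate_part s).
     (a + c) mod p = (a' + c') mod p}"

lemma finite_translate_part: "finite (translate_part s)"
  unfolding translate_part_def using finite_R by simp

lemma card_translate_part: "card (translate_part s) = drep s"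
proof -
  have "bij_betw fst (diff_pairs s) (translate_part s)"
    unfolding bij_betw_def
  proof
    show "inj_on fst (diff_pairs s)"
    proof (rule inj_onI)
      fix x y assume "x \<in> diff_pairs s" "y \<in> diff_pairs s" "fst x = fst y"
      then obtain a b b' where xy: "x = (a, b)" "y = (a, b')" "b \<in> R" "b' \<in> R"
        "[a - b = s] (mod p)" "[a - b' = s] (mod p)"
        by (cases x; cases y) auto
      then have "[a - (a - b) = a - (a - b')] (mod p)"
        using cong_diff[OF cong_refl cong_trans[OF xy(5) cong_sym[OF xy(6)]]] by blast
      then show "x = y"
        using xy residue_eqI_R by simp
    qed
    show "fst ` diff_pairs s = translate_part s"
    proof (intro equalityI subsetI)
      fix c assume "c \<in> fst ` diff_pairs s"
      then obtain d where d: "c \<in> R" "d \<in> R" "[c - d = s] (mod p)"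
        by auto
      then have "[c - s = c - (c - d)] (mod p)"
        using cong_diff[OF cong_refl cong_sym[OF d(3)]] by blast
      then have "(c - s) mod p = d mod p"
        by (simp add: unique_euclidean_semiring_class.cong_def)
      also have "\<dots> = d"
        using d(2) R_subset by (intro mod_pos_pos_trivial) auto
      finally show "c \<in> translate_part s"
        unfolding translate_part_def using d by simp
    next
      fix c assume c: "c \<in> translate_part s"
      have "[c - (c - s) mod p = c - (c - s)] (mod p)"
        by (intro cong_diff) simp_all
      then have "(c, (c - s) mod p) \<in> diff_pairs s"
        using c unfolding translate_part_def by simp
      then show "c \<in> fst ` diff_pairs s"
        by force
    qed
  qed
  then have "card (diff_pairs s) = card (translate_part s)"
    by (rule bij_betw_same_card)
  then show ?thesis
    unfolding diff_count_def by simp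
qed

text \<open>For a in R and c in \<open>translate_part s\<close>, both a + c and a + (c - s) are sums
  of two elements of R, so each value of a + c gives a representation of s as a difference of
  elements of \<open>RR\<close>. Cauchy-Schwarz bounds the number of values of a + c from
  below.\<close>

lemma katz_koester: "(card R * drep s)\<^sup>2 \<le> diff_count RR s * collisions s"
proof -
  let ?I = "R \<times> translate_part s"
  let ?g = "\<lambda>(a, c). (a + c) mod p"
  have "?g ` ?I \<subseteq> {x \<in> RR. (x - s) mod p \<in> RR}"
  proof clarify
    fix a c assume a: "a \<in> R" and c: "c \<in> translate_part s"
    then have "c \<in> R" "(c - s) mod p \<in> R"
      unfolding translate_part_def by auto
    then have "(a + c) mod p \<in> RR" "(a + (c - s) mod p) mod p \<in> RR"
      unfolding RR_def using a by auto
    moreover have "((a + c) mod p - s) mod p = (a + (c - s) mod p) mod p"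
      by (simp add: mod_simps add_diff_eq)
    ultimately show "(a + c) mod p \<in> RR \<and> ((a + c) mod p - s) mod p \<in> RR"
      by simp
  qed
  then have "card (?g ` ?I) \<le> card {x \<in> RR. (x - s) mod p \<in> RR}"
    using finite_RR by (intro card_mono) auto
  also have "\<dots> \<le> diff_count RR s"
    unfolding diff_count_def
  proof (rule card_inj_on_le)
    show "inj_on (\<lambda>x. (x, (x - s) mod p)) {x \<in> RR. (x - s) mod p \<in> RR}"
      by (auto simp: inj_on_def)
    have "[x - (x - s) mod p = x - (x - s)] (mod p)" for x
      by (intro cong_diff) simp_all
    then show "(\<lambda>x. (x, (x - s) mod p)) ` {x \<in> RR. (x - s) mod p \<in> RR} \<subseteq>
        {(a, b) \<in> RR \<times> RR. [a - b = s] (mod p)}"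
      by auto
    show "finite {(a, b) \<in> RR \<times> RR. [a - b = s] (mod p)}"
      using finite_RR by (auto intro: finite_subset[of _ "RR \<times> RR"])
  qed
  finally have "card (?g ` ?I) \<le> diff_count RR s" .
  moreover have "(card ?I)\<^sup>2 \<le> card (?g ` ?I) * collisions s"
  proof -
    have "collisions s = card {(i, j) \<in> ?I \<times> ?I. ?g i = ?g j}"
      unfolding collisions_def by (rule arg_cong[of _ _ card]) auto
    then show ?thesis
      using card_sq_le_image_collisions[of ?I ?g] finite_R finite_translate_part by simp
  qed
  ultimately have "(card ?I)\<^sup>2 \<le> diff_count RR s * collisions s"
    by (meson mult_le_mono1 order_trans)
  then show ?thesis
    by (simp add: card_cartesian_product card_translate_part)
qed

text \<open>A collision a + c = a' + c' gives three representations of one difference: a - a' = c' -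
  c = (c' - s) - (c - s). They determine s, as c and c - s both occur. The index of the target sum
  is this common difference, no longer s.\<close>

lemma sum_collisions_le: "(\<Sum>s\<in>{0..<p}. real (collisions s)) \<le> energy3"
proof -
  define Q where "Q s = {((a, c), (a', c')) \<in> (R \<times> translate_part s) \<times> (R \<times> translate_part s).
     (a + c) mod p = (a' + c') mod p}" for s
  let ?C = "SIGMA s:{0..<p}. Q s"
  let ?T = "SIGMA s:{0..<p}. diff_pairs s \<times> diff_pairs s \<times> diff_pairs s"
  let ?f = "\<lambda>(s, ((a, c), (a', c'))). ((a - a') mod p, (a, a'), (c', c), ((c' - s) mod p, (c - s) mod p))"
  have finQ: "finite (Q s)" for s
    unfolding Q_def using finite_R finite_translate_part
    by (auto intro: finite_subset[of _ "(R \<times> translate_part s) \<times> (R \<times> translate_part s)"])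
  have "inj_on ?f ?C"
  proof (rule inj_onI)
    fix x y assume xy: "x \<in> ?C" "y \<in> ?C" "?f x = ?f y"
    obtain s a c a' c' where x: "x = (s, ((a, c), (a', c')))"
      by (cases x) auto
    obtain s1 a1 c1 a1' c1' where y: "y = (s1, ((a1, c1), (a1', c1')))"
      by (cases y) auto
    have eq: "a = a1" "a' = a1'" "c = c1" "c' = c1'" "(c - s) mod p = (c1 - s1) mod p"
      using xy(3) unfolding x y by auto
    then have "[c - s = c - s1] (mod p)"
      by (simp add: unique_euclidean_semiring_class.cong_def)
    then have "[c - (c - s) = c - (c - s1)] (mod p)"
      by (rule cong_diff[OF cong_refl])
    then have "s = s1"
      using xy(1,2) unfolding x y by (intro residue_eqI) auto
    with eq show "x = y"
      unfolding x y by simp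
  qed
  moreover have "?f ` ?C \<subseteq> ?T"
  proof (rule image_subsetI)
    fix x assume "x \<in> ?C"
    then obtain s a c a' c' where x: "x = (s, ((a, c), (a', c')))" and
      R: "a \<in> R" "a' \<in> R" "c \<in> translate_part s" "c' \<in> translate_part s"
      and eq: "(a + c) mod p = (a' + c') mod p"
      unfolding Q_def by auto
    have "[a + c = a' + c'] (mod p)"
      using eq by (simp add: unique_euclidean_semiring_class.cong_def)
    then have "[a + c - (a' + c) = a' + c' - (a' + c)] (mod p)"
      by (rule cong_diff) simp
    then have 1: "[c' - c = a - a'] (mod p)"
      by (simp add: cong_sym)
    have "[(c' - s) mod p - (c - s) mod p = (c' - s) - (c - s)] (mod p)"
      by (intro cong_diff) simp_all
    then have "[(c' - s) mod p - (c - s) mod p = c' - c] (mod p)"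
      by simp
    then have 2: "[(c' - s) mod p - (c - s) mod p = a - a'] (mod p)"
      using 1 cong_trans by blast
    show "?f x \<in> ?T"
      using R 1 2 p_gt_1 unfolding x translate_part_def by simp
  qed
  moreover have "finite ?T"
    using finite_diff_pairs by auto
  ultimately have "card ?C \<le> card ?T"
    by (rule card_inj_on_le)
  moreover have "card ?T = (\<Sum>s\<in>{0..<p}. drep s ^ 3)"
    unfolding diff_count_def using finite_diff_pairs
    by (subst card_SigmaI) (auto simp: card_cartesian_product power3_eq_cube mult.assoc)
  moreover have "card ?C = (\<Sum>s\<in>{0..<p}. collisions s)"
    using finQ by (subst card_SigmaI) (auto simp: Q_def collisions_def)
  ultimately have "real (\<Sum>s\<in>{0..<p}. collisions s) \<le> real (\<Sum>s\<in>{0..<p}. drep s ^ 3)"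
    by (simp only: of_nat_le_iff)
  then show ?thesis
    unfolding energy3_def by simp
qed

section \<open>Bounding the nontrivial Fourier coefficients of R\<close>

lemma card_R_norm_FT_sq_le:
  "real (card R) * (norm (FT R \<xi>))\<^sup>2 \<le> (\<Sum>s\<in>{0..<p}. real (drep s) * norm (FT R (\<xi> * s)))"
proof -
  have "complex_of_real (real (card R) * (norm (FT R \<xi>))\<^sup>2) = (\<Sum>c\<in>R. complex_of_real ((norm (FT R (\<xi> * c)))\<^sup>2))"
    by (simp add: FT_invariant[OF invariant_R])
  also have "\<dots> = (\<Sum>c\<in>R. \<Sum>x\<in>R \<times> R. e (\<xi> * c * (fst x - snd x)))"
    unfolding norm_FT_sq by (simp add: split_beta)
  also have "\<dots> = (\<Sum>x\<in>R \<times> R. \<Sum>c\<in>R. e (\<xi> * c * (fst x - snd x)))"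
    by (rule sum.swap)
  also have "\<dots> = (\<Sum>x\<in>R \<times> R. FT R (\<xi> * (fst x - snd x)))"
    unfolding FT_def by (intro sum.cong refl arg_cong[of _ _ e]) simp
  finally have eq: "complex_of_real (real (card R) * (norm (FT R \<xi>))\<^sup>2) =
      (\<Sum>x\<in>R \<times> R. FT R (\<xi> * (fst x - snd x)))" .
  have "norm (complex_of_real (real (card R) * (norm (FT R \<xi>))\<^sup>2)) \<le>
      (\<Sum>x\<in>R \<times> R. norm (FT R (\<xi> * (fst x - snd x))))"
    unfolding eq by (rule norm_sum)
  also have "\<dots> = (\<Sum>(a, b)\<in>R \<times> R. norm (FT R (\<xi> * ((a - b) mod p))))"
    by (simp add: split_beta)
  also have "\<dots> = (\<Sum>s\<in>{0..<p}. real (drep s) * norm (FT R (\<xi> * s)))"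
    by (rule sum_diff_count[OF finite_R])
  finally show ?thesis
    by (simp only: norm_of_real)
qed

lemma sum_norm_FT_sq_dilate_le:
  assumes "A \<subseteq> {0..<p}" "\<not> p dvd \<xi>"
  shows "(\<Sum>y\<in>{1..<p}. (norm (FT A (\<xi> * y)))\<^sup>2) \<le> of_int p * real (card A)"
proof -
  have inj: "inj_on (\<lambda>y. \<xi> * y mod p) {1..<p}"
    using assms(2) by (intro inj_mult_mod) auto
  have "(\<Sum>y\<in>{1..<p}. (norm (FT A (\<xi> * y)))\<^sup>2) = (\<Sum>\<eta>\<in>(\<lambda>y. \<xi> * y mod p) ` {1..<p}. (norm (FT A \<eta>))\<^sup>2)"
    by (subst sum.reindex[OF inj]) simp
  also have "\<dots> \<le> (\<Sum>\<eta>\<in>{0..<p}. (norm (FT A \<eta>))\<^sup>2)"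
    using p_gt_1 by (intro sum_mono2) auto
  finally show ?thesis
    using parseval[OF assms(1)] by simp
qed

lemma not_dvd_residue: "y \<in> {1..<p} \<Longrightarrow> \<not> p dvd y"
  using zdvd_not_zless[of y p] by simp

lemma energy2_nonneg: "energy2 \<ge> 0"
  unfolding energy2_def by (intro sum_nonneg) simp

lemma card_R_pos: "card R > 0"
  using finite_R one_in by (auto simp: card_gt_0_iff)

lemma FT_R_power4_le:
  assumes "\<not> p dvd \<xi>"
  shows "real (card R) ^ 4 * norm (FT R \<xi>) ^ 4 \<le>
    energy3 * (real (card R) * (real (card RR))\<^sup>2
      + sqrt energy2 * of_int p * real (card RR) / sqrt (real (card R)))"
proof -
  define t S where "t = real (card R)" and "S = real (card RR)"
  have t: "t > 0"
    unfolding t_def using card_R_pos by simp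
  define f where "f s = norm (FT R (\<xi> * s))" for s
  have f0: "f s \<ge> 0" for s
    unfolding f_def by simp
  have dilate: "\<not> p dvd \<xi> * y" if "y \<in> {1..<p}" for y
    using assms not_dvd_residue[OF that] prime_dvd_mult_iff[OF prime] by simp
  have "t * (t * (norm (FT R \<xi>))\<^sup>2) \<le> (\<Sum>s\<in>{0..<p}. t * real (drep s) * f s)"
    using mult_left_mono[OF card_R_norm_FT_sq_le[of \<xi>], of t] t
    unfolding f_def t_def by (simp add: sum_distrib_left mult.assoc)
  \<comment> \<open>Katz-Koester bounds \<open>t * drep s\<close> by a geometric mean. Separating
    its two factors prepares Cauchy-Schwarz, where the sum of \<open>collisions\<close> costs only
    \<open>energy3\<close>.\<close>
  also have "\<dots> \<le> (\<Sum>s\<in>{0..<p}. (f s * sqrt (real (diff_count RR s))) * sqrt (real (collisions s)))"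
  proof (rule sum_mono)
    fix s
    have "real ((card R * drep s)\<^sup>2) \<le> real (diff_count RR s * collisions s)"
      using katz_koester by (simp only: of_nat_le_iff)
    then have "(t * real (drep s))\<^sup>2 \<le> real (diff_count RR s) * real (collisions s)"
      unfolding t_def by simp
    then have "t * real (drep s) \<le> sqrt (real (diff_count RR s) * real (collisions s))"
      by (rule real_le_rsqrt)
    then have "t * real (drep s) * f s \<le> sqrt (real (diff_count RR s) * real (collisions s)) * f s"
      using f0 by (rule mult_right_mono)
    then show "t * real (drep s) * f s \<le> f s * sqrt (real (diff_count RR s)) * sqrt (real (collisions s))"
      by (simp add: real_sqrt_mult mult_ac)
  qed
  finally have "(t * (t * (norm (FT R \<xi>))\<^sup>2))\<^sup>2 \<le>
      (\<Sum>s\<in>{0..<p}. (f s * sqrt (real (diff_count RR s))) * sqrt (real (collisions s)))\<^sup>2"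
    using t by (intro power_mono) auto
  also have "\<dots> \<le> (\<Sum>s\<in>{0..<p}. (f s * sqrt (real (diff_count RR s)))\<^sup>2) * (\<Sum>s\<in>{0..<p}. (sqrt (real (collisions s)))\<^sup>2)"
    by (rule Cauchy_Schwarz_ineq_sum)
  also have "(\<Sum>s\<in>{0..<p}. (f s * sqrt (real (diff_count RR s)))\<^sup>2) = (\<Sum>s\<in>{0..<p}. real (diff_count RR s) * (f s)\<^sup>2)"
    by (simp add: power_mult_distrib mult.commute)
  also have "\<dots> = (\<Sum>(x, y)\<in>RR \<times> RR. (f ((x - y) mod p))\<^sup>2)"
    by (rule sum_diff_count[OF finite_RR, symmetric])
  \<comment> \<open>Duality replaces differences of elements of \<open>RR\<close> by differences of
    elements of R, whose multiplicities \<open>drep\<close> are controlled; the price is the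
    transform of \<open>RR\<close> in place of that of R.\<close>
  also have "\<dots> = (\<Sum>(a, b)\<in>R \<times> R. (norm (FT RR (\<xi> * (a - b))))\<^sup>2)"
    unfolding f_def by (simp add: FT_duality)
  also have "\<dots> = (\<Sum>(a, b)\<in>R \<times> R. (norm (FT RR (\<xi> * ((a - b) mod p))))\<^sup>2)"
    by simp
  also have "\<dots> = (\<Sum>y\<in>{0..<p}. real (drep y) * (norm (FT RR (\<xi> * y)))\<^sup>2)"
    by (rule sum_diff_count[OF finite_R])
  also have "\<dots> = t * S\<^sup>2 + (\<Sum>y\<in>{1..<p}. real (drep y) * (norm (FT RR (\<xi> * y)))\<^sup>2)"
    unfolding atLeastLessThan_insert_0 t_def S_def by (simp add: drep_0 FT_0)
  also have "(\<Sum>s\<in>{0..<p}. (sqrt (real (collisions s)))\<^sup>2) = (\<Sum>s\<in>{0..<p}. real (collisions s))"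
    by simp
  finally have main: "(t * (t * (norm (FT R \<xi>))\<^sup>2))\<^sup>2 \<le>
      (t * S\<^sup>2 + (\<Sum>y\<in>{1..<p}. real (drep y) * (norm (FT RR (\<xi> * y)))\<^sup>2)) * (\<Sum>s\<in>{0..<p}. real (collisions s))" .
  define Y where "Y = (\<Sum>y\<in>{1..<p}. real (drep y) * (norm (FT RR (\<xi> * y)))\<^sup>2)"
  have Y0: "Y \<ge> 0"
    unfolding Y_def by (intro sum_nonneg) simp
  \<comment> \<open>Cauchy-Schwarz separates \<open>energy2\<close> from the fourth moment of the
    transform of \<open>RR\<close>. That moment is at most the largest square, p S / t by
    invariance, times the second moment, p S by Parseval.\<close>
  have "Y\<^sup>2 \<le> (\<Sum>y\<in>{1..<p}. (real (drep y))\<^sup>2) * (\<Sum>y\<in>{1..<p}. ((norm (FT RR (\<xi> * y)))\<^sup>2)\<^sup>2)"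
    unfolding Y_def by (rule Cauchy_Schwarz_ineq_sum)
  also have "\<dots> \<le> energy2 * ((of_int p * S / t) * (of_int p * S))"
  proof (rule mult_mono)
    show "(\<Sum>y\<in>{1..<p}. (real (drep y))\<^sup>2) \<le> energy2"
      unfolding energy2_def by (intro sum_mono2) auto
    have "(\<Sum>y\<in>{1..<p}. ((norm (FT RR (\<xi> * y)))\<^sup>2)\<^sup>2) \<le> (\<Sum>y\<in>{1..<p}. (of_int p * S / t) * (norm (FT RR (\<xi> * y)))\<^sup>2)"
    proof (rule sum_mono)
      fix y assume "y \<in> {1..<p}"
      then have "t * (norm (FT RR (\<xi> * y)))\<^sup>2 \<le> of_int p * S"
        unfolding t_def S_def using FT_invariant_bound[OF invariant_RR dilate] by simp
      then have "(norm (FT RR (\<xi> * y)))\<^sup>2 \<le> of_int p * S / t"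
        using t by (simp add: field_simps)
      then show "((norm (FT RR (\<xi> * y)))\<^sup>2)\<^sup>2 \<le> (of_int p * S / t) * (norm (FT RR (\<xi> * y)))\<^sup>2"
        unfolding power2_eq_square[of "(norm (FT RR (\<xi> * y)))\<^sup>2"] by (intro mult_right_mono) auto
    qed
    also have "\<dots> = (of_int p * S / t) * (\<Sum>y\<in>{1..<p}. (norm (FT RR (\<xi> * y)))\<^sup>2)"
      by (simp only: sum_distrib_left)
    also have "\<dots> \<le> (of_int p * S / t) * (of_int p * S)"
      using sum_norm_FT_sq_dilate_le[OF RR_subset assms] t p_gt_1 unfolding S_def
      by (intro mult_left_mono) auto
    finally show "(\<Sum>y\<in>{1..<p}. ((norm (FT RR (\<xi> * y)))\<^sup>2)\<^sup>2) \<le> (of_int p * S / t) * (of_int p * S)" .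
  qed (use energy2_nonneg in \<open>auto intro: sum_nonneg\<close>)
  also have "\<dots> = (sqrt energy2 * of_int p * S / sqrt t)\<^sup>2"
    using energy2_nonneg t by (simp add: power_mult_distrib power_divide power2_eq_square[of S] power2_eq_square[of "real_of_int p"])
  finally have Y_sq: "Y\<^sup>2 \<le> (sqrt energy2 * of_int p * S / sqrt t)\<^sup>2" .
  have "0 \<le> sqrt energy2 * of_int p * S / sqrt t"
    unfolding S_def using energy2_nonneg t p_gt_1 by simp
  with Y_sq have Y_le: "Y \<le> sqrt energy2 * of_int p * S / sqrt t"
    by (rule power2_le_imp_le)
  have "t ^ 4 * norm (FT R \<xi>) ^ 4 = (t * (t * (norm (FT R \<xi>))\<^sup>2))\<^sup>2"
    by (simp add: power_mult_distrib power2_eq_square power_numeral_reduce)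
  also have "\<dots> \<le> (t * S\<^sup>2 + Y) * (\<Sum>s\<in>{0..<p}. real (collisions s))"
    using main unfolding Y_def .
  also have "\<dots> \<le> (t * S\<^sup>2 + sqrt energy2 * of_int p * S / sqrt t) * energy3"
    using Y_le Y0 t sum_collisions_le by (intro mult_mono) (auto intro!: add_nonneg_nonneg sum_nonneg)
  finally show ?thesis
    unfolding t_def S_def by (simp add: mult.commute)
qed

section \<open>The consequence of a missing coset\<close>

text \<open>By orthogonality the sum of K over all frequencies is p times the number of solutions of
  x + y + a + b = l c, hence zero. The term at 0 is |RR|^2 t^3. Elsewhere the three factors from R
  cost \<rho>^3, the two from \<open>RR\<close> are handled by Parseval, and one factor |RR|
  cancels.\<close>

lemma no_representation_bound:
  fixes \<rho> :: real
  assumes "\<not> p dvd l" and \<rho>: "\<And>\<xi>. \<not> p dvd \<xi> \<Longrightarrow> norm (FT R \<xi>) \<le> \<rho>"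
    and no: "\<And>x y a b c. x \<in> RR \<Longrightarrow> y \<in> RR \<Longrightarrow> a \<in> R \<Longrightarrow> b \<in> R \<Longrightarrow> c \<in> R \<Longrightarrow>
      \<not> [x + y + a + b = l * c] (mod p)"
  shows "real (card RR) * real (card R) ^ 3 \<le> of_int p * \<rho> ^ 3"
proof -
  define K where "K \<xi> = FT RR \<xi> * FT RR \<xi> * FT R \<xi> * FT R \<xi> * cnj (FT R (\<xi> * l))" for \<xi>
  define I where "I = (((RR \<times> RR) \<times> R) \<times> R) \<times> R"
  have K: "K \<xi> = (\<Sum>((((x, y), a), b), c)\<in>I. e (\<xi> * (x + y + a + b + (- (l * c)))))" for \<xi>
  proof -
    have 1: "FT RR \<xi> * FT RR \<xi> = (\<Sum>u\<in>RR \<times> RR. e (\<xi> * (fst u + snd u)))"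
      unfolding FT_def using sum_e_mult[of \<xi> "\<lambda>a. a" RR "\<lambda>a. a" RR] by (simp add: split_beta)
    have 2: "FT RR \<xi> * FT RR \<xi> * FT R \<xi> = (\<Sum>u\<in>(RR \<times> RR) \<times> R. e (\<xi> * (fst (fst u) + snd (fst u) + snd u)))"
      unfolding 1 unfolding FT_def
      using sum_e_mult[of \<xi> "\<lambda>u. fst u + snd u" "RR \<times> RR" "\<lambda>a. a" R] by (simp add: split_beta)
    have 3: "FT RR \<xi> * FT RR \<xi> * FT R \<xi> * FT R \<xi> = (\<Sum>u\<in>((RR \<times> RR) \<times> R) \<times> R.
        e (\<xi> * (fst (fst (fst u)) + snd (fst (fst u)) + snd (fst u) + snd u)))"
      unfolding 2 unfolding FT_def
      using sum_e_mult[of \<xi> "\<lambda>u. fst (fst u) + snd (fst u) + snd u" "(RR \<times> RR) \<times> R" "\<lambda>a. a" R]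
      by (simp add: split_beta)
    have 4: "cnj (FT R (\<xi> * l)) = (\<Sum>c\<in>R. e (\<xi> * (- (l * c))))"
      unfolding cnj_FT by (simp add: mult.assoc)
    show ?thesis
      unfolding K_def 3 4 I_def
      using sum_e_mult[of \<xi> "\<lambda>u. fst (fst (fst u)) + snd (fst (fst u)) + snd (fst u) + snd u"
          "((RR \<times> RR) \<times> R) \<times> R" "\<lambda>c. - (l * c)" R]
      by (simp add: split_beta)
  qed
  have "(\<Sum>\<xi>\<in>{0..<p}. K \<xi>) = (\<Sum>((((x, y), a), b), c)\<in>I. \<Sum>\<xi>\<in>{0..<p}. e (\<xi> * (x + y + a + b + (- (l * c)))))"
    unfolding K split_beta by (rule sum.swap)
  also have "\<dots> = 0"
  proof (rule sum.neutral, clarify)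
    fix x y a b c assume "((((x, y), a), b), c) \<in> I"
    then have "\<not> [x + y + a + b = l * c] (mod p)"
      using no unfolding I_def by auto
    then have "\<not> p dvd x + y + a + b + (- (l * c))"
      by (simp add: cong_iff_dvd_diff)
    then show "(\<Sum>\<xi>\<in>{0..<p}. e (\<xi> * (x + y + a + b + (- (l * c))))) = 0"
      by (simp only: sum_e if_False)
  qed
  finally have "K 0 = - (\<Sum>\<xi>\<in>{1..<p}. K \<xi>)"
    unfolding atLeastLessThan_insert_0 by (simp add: eq_neg_iff_add_eq_0)
  then have "norm (K 0) \<le> (\<Sum>\<xi>\<in>{1..<p}. norm (K \<xi>))"
    by (simp add: norm_sum)
  also have "norm (K 0) = (real (card RR))\<^sup>2 * real (card R) ^ 3"
    unfolding K_def by (simp add: FT_0 norm_mult power2_eq_square power3_eq_cube)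
  also have "(\<Sum>\<xi>\<in>{1..<p}. norm (K \<xi>)) \<le> (\<Sum>\<xi>\<in>{1..<p}. (norm (FT RR \<xi>))\<^sup>2 * \<rho> ^ 3)"
  proof (rule sum_mono)
    fix \<xi> assume "\<xi> \<in> {1..<p}"
    then have "\<not> p dvd \<xi>"
      by (rule not_dvd_residue)
    moreover from this have "\<not> p dvd \<xi> * l"
      using assms(1) prime_dvd_mult_iff[OF prime] by simp
    ultimately have "norm (FT R \<xi>) \<le> \<rho>" "norm (FT R (\<xi> * l)) \<le> \<rho>"
      using \<rho> by auto
    then have "norm (FT R \<xi>) * norm (FT R \<xi>) * norm (FT R (\<xi> * l)) \<le> \<rho> * \<rho> * \<rho>"
      by (intro mult_mono) (auto intro: order_trans[OF norm_ge_zero])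
    then have "(norm (FT RR \<xi>))\<^sup>2 * (norm (FT R \<xi>) * norm (FT R \<xi>) * norm (FT R (\<xi> * l))) \<le>
        (norm (FT RR \<xi>))\<^sup>2 * (\<rho> * \<rho> * \<rho>)"
      by (rule mult_left_mono) simp
    then show "norm (K \<xi>) \<le> (norm (FT RR \<xi>))\<^sup>2 * \<rho> ^ 3"
      unfolding K_def by (simp add: norm_mult power2_eq_square power3_eq_cube mult.assoc)
  qed
  also have "\<dots> = (\<Sum>\<xi>\<in>{1..<p}. (norm (FT RR (1 * \<xi>)))\<^sup>2) * \<rho> ^ 3"
    by (simp add: sum_distrib_right)
  also have "\<dots> \<le> of_int p * real (card RR) * \<rho> ^ 3"
  proof (rule mult_right_mono)
    show "(\<Sum>\<xi>\<in>{1..<p}. (norm (FT RR (1 * \<xi>)))\<^sup>2) \<le> of_int p * real (card RR)"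
      using p_gt_1 by (intro sum_norm_FT_sq_dilate_le RR_subset) auto
    have "\<not> p dvd 1"
      using p_gt_1 by simp
    then show "\<rho> ^ 3 \<ge> 0"
      using \<rho>[of 1] by (intro zero_le_power order_trans[OF norm_ge_zero])
  qed
  finally have *: "(real (card RR))\<^sup>2 * real (card R) ^ 3 \<le> of_int p * real (card RR) * \<rho> ^ 3"
    by simp
  have "card RR > 0"
    using one_in finite_RR unfolding RR_def by (auto simp: card_gt_0_iff)
  then show ?thesis
    using * by (simp add: power2_eq_square mult.assoc mult.left_commute)
qed

end

section \<open>Comparison of the bounds\<close>

text \<open>Eliminates \<rho>, S and E, with G as the logarithmic factor. All inequalities are
  raised to powers that clear the square roots hidden in E \<le> (G t^5)^(1/2) and in w = (E /
  t)^(1/2).\<close>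

lemma small_subgroup_arith:
  fixes t S p \<rho> E E3 G :: real
  assumes pos: "t > 0" "S > 0" "p > 0" "\<rho> \<ge> 0" "E \<ge> 0" "G > 0"
    and E3: "E3 \<le> G * t ^ 3" and EE: "E\<^sup>2 \<le> t\<^sup>2 * E3" and SE: "t ^ 4 \<le> S * E"
    and \<rho>1: "t * \<rho> ^ 4 \<le> p * E" and II: "S * t ^ 3 \<le> p * \<rho> ^ 3"
    and I: "t ^ 4 * \<rho> ^ 4 \<le> E3 * (t * S\<^sup>2 + sqrt E * p * S / sqrt t)"
  shows "t ^ 21 \<le> 16 * G ^ 5 * p ^ 10 \<or> t ^ 57 \<le> 4096 * G ^ 17 * p ^ 28"
proof -
  define w where "w = sqrt E / sqrt t"
  have w: "w \<ge> 0" "w\<^sup>2 = E / t"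
    using pos by (simp_all add: w_def power_divide)
  have E2: "E\<^sup>2 \<le> G * t ^ 5"
  proof -
    have "t\<^sup>2 * E3 \<le> t\<^sup>2 * (G * t ^ 3)"
      using E3 by (rule mult_left_mono) simp
    also have "\<dots> = G * t ^ 5"
      by (simp add: power_numeral_reduce)
    finally show ?thesis
      using EE by linarith
  qed
  \<comment> \<open>Strict positivity allows \<rho>^8 to be cancelled in the first case.\<close>
  have "\<rho> ^ 3 > 0"
  proof (rule ccontr)
    assume "\<not> \<rho> ^ 3 > 0"
    then have "p * \<rho> ^ 3 \<le> 0"
      using pos by (simp add: mult_nonneg_nonpos)
    moreover have "S * t ^ 3 > 0"
      using pos by simp
    ultimately show False
      using II by linarith
  qed
  then have \<rho>: "\<rho> > 0"
    using pos(4) by (cases "\<rho> = 0") auto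
  have II4: "S ^ 4 * t ^ 12 \<le> p ^ 4 * \<rho> ^ 12"
    using power_mono[OF II, of 4] pos by (simp add: power_mult_distrib flip: power_mult)
  have "t ^ 8 \<le> S\<^sup>2 * E\<^sup>2"
    using power_mono[OF SE, of 2] pos by (simp add: power_mult_distrib flip: power_mult)
  also have "\<dots> \<le> S\<^sup>2 * (G * t ^ 5)"
    using E2 by (intro mult_left_mono) auto
  finally have "t ^ 5 * t ^ 3 \<le> t ^ 5 * (S\<^sup>2 * G)"
    by (simp add: mult_ac flip: power_add)
  then have S2: "t ^ 3 \<le> S\<^sup>2 * G"
    by (rule mult_left_le_imp_le) (use pos in simp)
  have "t ^ 4 * \<rho> ^ 4 \<le> G * t ^ 3 * (t * S\<^sup>2 + p * S * w)"
  proof (rule order_trans[OF I])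
    have "t * S\<^sup>2 + p * S * w \<ge> 0"
      using pos w(1) by simp
    moreover have "sqrt E * p * S / sqrt t = p * S * w"
      by (simp add: w_def)
    ultimately show "E3 * (t * S\<^sup>2 + sqrt E * p * S / sqrt t) \<le> G * t ^ 3 * (t * S\<^sup>2 + p * S * w)"
      using E3 mult_right_mono by metis
  qed
  also have "t ^ 4 * \<rho> ^ 4 = t ^ 3 * (t * \<rho> ^ 4)"
    by (simp add: power_numeral_reduce)
  finally have "t ^ 3 * (t * \<rho> ^ 4) \<le> t ^ 3 * (G * (t * S\<^sup>2 + p * S * w))"
    by (simp add: mult_ac)
  then have I': "t * \<rho> ^ 4 \<le> G * (t * S\<^sup>2 + p * S * w)"
    by (rule mult_left_le_imp_le) (use pos in simp)
  show ?thesis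
  proof (cases "p * S * w \<le> t * S\<^sup>2")
    \<comment> \<open>The diagonal term dominates: \<rho>^4 \<le> 2 G S^2. Its square, put into the
      fourth power of \<open>II\<close>, removes S and leaves \<rho>^4, which \<open>\<rho>1\<close>
      bounds by p E / t.\<close>
    case True
    then have "G * (t * S\<^sup>2 + p * S * w) \<le> G * (2 * (t * S\<^sup>2))"
      using pos by (intro mult_left_mono) auto
    with I' have "t * \<rho> ^ 4 \<le> t * (2 * G * S\<^sup>2)"
      by (simp add: mult_ac)
    then have r4: "\<rho> ^ 4 \<le> 2 * G * S\<^sup>2"
      by (rule mult_left_le_imp_le) (use pos in simp)
    then have r8: "\<rho> ^ 8 \<le> 4 * G\<^sup>2 * S ^ 4"
      using power_mono[OF r4, of 2] by (simp add: power_mult_distrib flip: power_mult)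
    have "\<rho> ^ 8 * t ^ 12 \<le> 4 * G\<^sup>2 * S ^ 4 * t ^ 12"
      using r8 pos by (intro mult_right_mono) auto
    also have "\<dots> \<le> 4 * G\<^sup>2 * (p ^ 4 * \<rho> ^ 12)"
      using mult_left_mono[OF II4, of "4 * G\<^sup>2"] by (simp add: mult.assoc)
    also have "\<rho> ^ 12 = \<rho> ^ 8 * \<rho> ^ 4"
      by (simp flip: power_add)
    finally have "\<rho> ^ 8 * t ^ 12 \<le> \<rho> ^ 8 * (4 * G\<^sup>2 * p ^ 4 * \<rho> ^ 4)"
      by (simp only: mult_ac)
    then have "t ^ 12 \<le> 4 * G\<^sup>2 * p ^ 4 * \<rho> ^ 4"
      by (rule mult_left_le_imp_le) (use \<rho> in simp)
    then have "t * t ^ 12 \<le> t * (4 * G\<^sup>2 * p ^ 4 * \<rho> ^ 4)"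
      using pos by (intro mult_left_mono) auto
    also have "\<dots> = 4 * G\<^sup>2 * p ^ 4 * (t * \<rho> ^ 4)"
      by simp
    also have "\<dots> \<le> 4 * G\<^sup>2 * p ^ 4 * (p * E)"
      using \<rho>1 pos by (intro mult_left_mono) auto
    finally have "(t ^ 13)\<^sup>2 \<le> (4 * G\<^sup>2 * p ^ 5 * E)\<^sup>2"
      using pos by (intro power_mono) (simp_all add: power_numeral_reduce mult_ac)
    also have "\<dots> = 16 * G ^ 4 * p ^ 10 * E\<^sup>2"
      by (simp add: power_mult_distrib flip: power_mult)
    also have "\<dots> \<le> 16 * G ^ 4 * p ^ 10 * (G * t ^ 5)"
      using E2 by (intro mult_left_mono) auto
    also have "\<dots> = t ^ 5 * (16 * G ^ 5 * p ^ 10)"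
      by (simp add: power_numeral_reduce)
    finally have "t ^ 5 * t ^ 21 \<le> t ^ 5 * (16 * G ^ 5 * p ^ 10)"
      by (simp flip: power_mult power_add)
    then have "t ^ 21 \<le> 16 * G ^ 5 * p ^ 10"
      by (rule mult_left_le_imp_le) (use pos in simp)
    then show ?thesis
      by blast
  next
    \<comment> \<open>The off-diagonal term dominates. The cube of \<open>r4\<close> and the fourth
      power of \<open>II\<close> both contain \<rho>^12; eliminating it leaves S t^15 \<le> 8 G^3
      p^7 w^3. Fourth powers then admit w^4 \<le> G t^3 and S^4 G^2 \<ge> t^6.\<close>
    case False
    then have "G * (t * S\<^sup>2 + p * S * w) \<le> G * (2 * (p * S * w))"
      using pos by (intro mult_left_mono) linarith+
    with I' have r4: "t * \<rho> ^ 4 \<le> 2 * G * p * S * w"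
      by (simp add: mult_ac)
    have r12: "t ^ 3 * \<rho> ^ 12 \<le> 8 * G ^ 3 * p ^ 3 * S ^ 3 * w ^ 3"
      using power_mono[OF r4, of 3] pos by (simp add: power_mult_distrib flip: power_mult)
    have "t ^ 3 * (S ^ 4 * t ^ 12) \<le> t ^ 3 * (p ^ 4 * \<rho> ^ 12)"
      using II4 pos by (intro mult_left_mono) auto
    also have "\<dots> = p ^ 4 * (t ^ 3 * \<rho> ^ 12)"
      by simp
    also have "\<dots> \<le> p ^ 4 * (8 * G ^ 3 * p ^ 3 * S ^ 3 * w ^ 3)"
      using r12 by (intro mult_left_mono) auto
    finally have "S ^ 3 * (S * t ^ 15) \<le> S ^ 3 * (8 * G ^ 3 * p ^ 7 * w ^ 3)"
      by (simp add: power_numeral_reduce mult_ac)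
    then have "S * t ^ 15 \<le> 8 * G ^ 3 * p ^ 7 * w ^ 3"
      by (rule mult_left_le_imp_le) (use pos in simp)
    then have "(S * t ^ 15) ^ 4 \<le> (8 * G ^ 3 * p ^ 7 * w ^ 3) ^ 4"
      using pos by (intro power_mono) auto
    then have le: "S ^ 4 * t ^ 60 \<le> 4096 * G ^ 12 * p ^ 28 * (w ^ 4) ^ 3"
      by (simp add: power_mult_distrib flip: power_mult)
    have "w ^ 4 = (w\<^sup>2)\<^sup>2"
      by simp
    also have "\<dots> \<le> G * t ^ 3"
      unfolding w(2) power_divide using E2 pos by (simp add: field_simps power_numeral_reduce)
    finally have w4: "(w ^ 4) ^ 3 \<le> (G * t ^ 3) ^ 3"
      using w(1) by (intro power_mono) auto
    have S4: "t ^ 6 \<le> S ^ 4 * G\<^sup>2"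
      using power_mono[OF S2, of 2] pos by (simp add: power_mult_distrib flip: power_mult)
    have "t ^ 6 * t ^ 60 \<le> S ^ 4 * G\<^sup>2 * t ^ 60"
      using S4 pos by (intro mult_right_mono) auto
    also have "\<dots> = G\<^sup>2 * (S ^ 4 * t ^ 60)"
      by simp
    also have "\<dots> \<le> G\<^sup>2 * (4096 * G ^ 12 * p ^ 28 * (G * t ^ 3) ^ 3)"
      using order_trans[OF le mult_left_mono[OF w4]] pos by (intro mult_left_mono) auto
    also have "\<dots> = t ^ 9 * (4096 * G ^ 17 * p ^ 28)"
      by (simp add: power_mult_distrib power_numeral_reduce mult_ac flip: power_mult)
    finally have "t ^ 9 * t ^ 57 \<le> t ^ 9 * (4096 * G ^ 17 * p ^ 28)"
      by (simp flip: power_add)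
    then have "t ^ 57 \<le> 4096 * G ^ 17 * p ^ 28"
      by (rule mult_left_le_imp_le) (use pos in simp)
    then show ?thesis
      by blast
  qed
qed

text \<open>Combining the hypotheses gives t^6 \<le> \<rho>^3 (t^3 + p^2) with \<rho> \<le> p^(1/2).
  So t is at most about p^(1/2) or p^(7/12), depending on the larger summand, while
  \<open>large\<close> makes it at least about p^(3/5). Since 7/12 < 3/5, p is bounded.\<close>

lemma large_subgroup_arith:
  fixes t S p \<rho> E :: real
  assumes pos: "t > 0" "S > 0" "p > 0" "\<rho> \<ge> 0" "E \<ge> 0"
    and SE: "t ^ 4 \<le> S * E" and E: "p * E \<le> t ^ 4 + p\<^sup>2 * t"
    and \<rho>: "\<rho>\<^sup>2 \<le> p" and II: "S * t ^ 3 \<le> p * \<rho> ^ 3" and large: "p ^ 3 \<le> 16 * t ^ 5"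
  shows "p \<le> 4 ^ 5 * 16 ^ 12"
proof -
  have "\<rho> ^ 6 = (\<rho>\<^sup>2) ^ 3"
    by (simp flip: power_mult)
  also have "\<dots> \<le> p ^ 3"
    using \<rho> by (intro power_mono) auto
  finally have \<rho>6: "\<rho> ^ 6 \<le> p ^ 3" .
  have "t ^ 4 * (p * t ^ 3) \<le> S * E * (p * t ^ 3)"
    using SE pos by (intro mult_right_mono) auto
  also have "\<dots> = (S * t ^ 3) * (p * E)"
    by simp
  also have "\<dots> \<le> (p * \<rho> ^ 3) * (t ^ 4 + p\<^sup>2 * t)"
    using pos by (intro mult_mono[OF II E]) auto
  finally have "(p * t) * t ^ 6 \<le> (p * t) * (\<rho> ^ 3 * (t ^ 3 + p\<^sup>2))"
    by (simp add: algebra_simps power_numeral_reduce)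
  then have t6: "t ^ 6 \<le> \<rho> ^ 3 * (t ^ 3 + p\<^sup>2)"
    by (rule mult_left_le_imp_le) (use pos in simp)
  \<comment> \<open>The exponents 60 here and 30 below are the common multiples of 5 with 12 and 6,
    at which the powers of t in the two cases can be compared.\<close>
  have large60: "p ^ 36 \<le> 16 ^ 12 * t ^ 60"
    using power_mono[OF large, of 12] pos by (simp add: power_mult_distrib flip: power_mult)
  have large30: "p ^ 18 \<le> 16 ^ 6 * t ^ 30"
    using power_mono[OF large, of 6] pos by (simp add: power_mult_distrib flip: power_mult)
  show ?thesis
  proof (cases "p\<^sup>2 \<le> t ^ 3")
    case True
    have "t ^ 6 \<le> \<rho> ^ 3 * (2 * t ^ 3)"
      using True pos by (intro order_trans[OF t6] mult_left_mono) auto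
    then have "t ^ 3 * t ^ 3 \<le> t ^ 3 * (2 * \<rho> ^ 3)"
      by (simp add: power_numeral_reduce mult_ac)
    then have t3: "t ^ 3 \<le> 2 * \<rho> ^ 3"
      by (rule mult_left_le_imp_le) (use pos in simp)
    have "(t ^ 3)\<^sup>2 \<le> 4 * \<rho> ^ 6"
      using power_mono[OF t3, of 2] pos by (simp add: power_mult_distrib flip: power_mult)
    also have "\<dots> \<le> 4 * p ^ 3"
      using \<rho>6 by simp
    finally have "((t ^ 3)\<^sup>2) ^ 5 \<le> (4 * p ^ 3) ^ 5"
      by (rule power_mono) simp
    then have "t ^ 30 \<le> 4 ^ 5 * p ^ 15"
      by (simp add: power_mult_distrib flip: power_mult)
    then have "16 ^ 6 * t ^ 30 \<le> 16 ^ 6 * (4 ^ 5 * p ^ 15)"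
      by (rule mult_left_mono) simp
    with large30 have "p ^ 15 * p ^ 3 \<le> p ^ 15 * (16 ^ 6 * 4 ^ 5)"
      by (simp add: mult_ac flip: power_add)
    then have p3: "p ^ 3 \<le> 16 ^ 6 * 4 ^ 5"
      by (rule mult_left_le_imp_le) (use pos in simp)
    show ?thesis
    proof (rule ccontr)
      assume "\<not> p \<le> 4 ^ 5 * 16 ^ 12"
      then have "(4 ^ 5 * 16 ^ 12) ^ 3 \<le> p ^ 3"
        by (intro power_mono) auto
      with p3 show False
        by simp
    qed
  next
    case False
    have "t ^ 6 \<le> \<rho> ^ 3 * (2 * p\<^sup>2)"
      using False pos by (intro order_trans[OF t6] mult_left_mono) auto
    then have "(t ^ 6)\<^sup>2 \<le> (\<rho> ^ 3 * (2 * p\<^sup>2))\<^sup>2"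
      by (rule power_mono) (use pos in simp)
    also have "\<dots> = 4 * p ^ 4 * \<rho> ^ 6"
      by (simp add: power_mult_distrib flip: power_mult)
    also have "\<dots> \<le> 4 * p ^ 4 * p ^ 3"
      using \<rho>6 by (intro mult_left_mono) auto
    also have "4 * p ^ 4 * p ^ 3 = 4 * p ^ 7"
      by (simp add: mult.assoc flip: power_add)
    finally have "((t ^ 6)\<^sup>2) ^ 5 \<le> (4 * p ^ 7) ^ 5"
      by (rule power_mono) simp
    then have "t ^ 60 \<le> 4 ^ 5 * p ^ 35"
      by (simp add: power_mult_distrib flip: power_mult)
    then have "16 ^ 12 * t ^ 60 \<le> 16 ^ 12 * (4 ^ 5 * p ^ 35)"
      by (rule mult_left_mono) simp
    with large60 have "p ^ 35 * p \<le> p ^ 35 * (4 ^ 5 * 16 ^ 12)"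
      by (simp add: mult_ac power_numeral_reduce)
    then show ?thesis
      by (rule mult_left_le_imp_le) (use pos in simp)
  qed
qed

section \<open>Combining both ranges of t\<close>

context prime_field_subgroup
begin

lemma ex_max_norm_FT:
  obtains \<xi> where "\<not> p dvd \<xi>" "\<And>\<eta>. \<not> p dvd \<eta> \<Longrightarrow> norm (FT R \<eta>) \<le> norm (FT R \<xi>)"
proof -
  let ?N = "(\<lambda>\<xi>. norm (FT R \<xi>)) ` {1..<p}"
  have N: "finite ?N" "?N \<noteq> {}"
    using p_gt_1 by auto
  obtain \<xi> where \<xi>: "Max ?N = norm (FT R \<xi>)" "\<xi> \<in> {1..<p}"
    using Max_in[OF N] by (rule imageE)
  have "norm (FT R \<eta>) \<le> norm (FT R \<xi>)" if "\<not> p dvd \<eta>" for \<eta>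
  proof -
    have "\<eta> mod p \<noteq> 0" "0 \<le> \<eta> mod p" "\<eta> mod p < p"
      using that p_gt_1 by auto
    then have "\<eta> mod p \<in> {1..<p}"
      by auto
    then have "norm (FT R (\<eta> mod p)) \<le> Max ?N"
      using N(1) by (intro Max_ge imageI)
    then show ?thesis
      using \<xi>(1) by simp
  qed
  then show ?thesis
    using that not_dvd_residue[OF \<xi>(2)] by blast
qed

text \<open>In the fourth moment the zero frequency gives t^4; at the others two factors cost p and
  Parseval gives p t for the remaining two.\<close>

lemma energy2_le:
  assumes "\<And>\<xi>. \<not> p dvd \<xi> \<Longrightarrow> (norm (FT R \<xi>))\<^sup>2 \<le> of_int p"
  shows "of_int p * energy2 \<le> real (card R) ^ 4 + (of_int p)\<^sup>2 * real (card R)"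
proof -
  have "(\<Sum>\<xi>\<in>{1..<p}. norm (FT R \<xi>) ^ 4) \<le> (\<Sum>\<xi>\<in>{1..<p}. of_int p * (norm (FT R (1 * \<xi>)))\<^sup>2)"
  proof (rule sum_mono)
    fix \<xi> assume "\<xi> \<in> {1..<p}"
    then have "(norm (FT R \<xi>))\<^sup>2 \<le> of_int p"
      using assms not_dvd_residue by blast
    then have "(norm (FT R \<xi>))\<^sup>2 * (norm (FT R \<xi>))\<^sup>2 \<le> of_int p * (norm (FT R \<xi>))\<^sup>2"
      by (rule mult_right_mono) simp
    then show "norm (FT R \<xi>) ^ 4 \<le> of_int p * (norm (FT R (1 * \<xi>)))\<^sup>2"
      by (simp flip: power_add)
  qed
  also have "\<dots> \<le> of_int p * (of_int p * real (card R))"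
    unfolding sum_distrib_left[symmetric] using p_gt_1 R_subset
    by (intro mult_left_mono sum_norm_FT_sq_dilate_le) auto
  finally show ?thesis
    unfolding fourth_moment[symmetric] atLeastLessThan_insert_0
    by (simp add: FT_0 power2_eq_square mult.assoc)
qed

lemma no_representation_cases:
  assumes "\<not> p dvd l"
    and no: "\<And>x y a b c. x \<in> RR \<Longrightarrow> y \<in> RR \<Longrightarrow> a \<in> R \<Longrightarrow> b \<in> R \<Longrightarrow> c \<in> R \<Longrightarrow>
      \<not> [x + y + a + b = l * c] (mod p)"
    and "16 \<le> card R"
  defines "t \<equiv> real (card R)" and "G \<equiv> 96001 * (1 + ln (real (card R)))"
  shows "of_int p \<le> (4 ^ 5 * 16 ^ 12 :: real) \<or> t ^ 21 \<le> 16 * G ^ 5 * of_int p ^ 10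
    \<or> t ^ 57 \<le> 4096 * G ^ 17 * of_int p ^ 28"
proof -
  obtain \<xi> where \<xi>: "\<not> p dvd \<xi>" "\<And>\<eta>. \<not> p dvd \<eta> \<Longrightarrow> norm (FT R \<eta>) \<le> norm (FT R \<xi>)"
    using ex_max_norm_FT by blast
  define \<rho> where "\<rho> = norm (FT R \<xi>)"
  have t: "t > 0"
    unfolding t_def using card_R_pos by simp
  have "card RR > 0"
    using one_in finite_RR unfolding RR_def by (auto simp: card_gt_0_iff)
  then have S: "real (card RR) > 0"
    by simp
  have p: "real_of_int p > 0"
    using p_gt_1 by simp
  have II: "real (card RR) * t ^ 3 \<le> of_int p * \<rho> ^ 3"
    using no_representation_bound[OF assms(1) _ no, of \<rho>] \<xi>(2) unfolding \<rho>_def t_def by blast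
  have SE: "t ^ 4 \<le> real (card RR) * energy2"
    unfolding t_def by (rule card_R_le_RR)
  show ?thesis
  \<comment> \<open>The threshold, t about p^(3/5), is where the third moment bound from Stepanov's
    method ends.\<close>
  proof (cases "int (16 * card R ^ 5) \<le> p ^ 3")
    case True
    have "ln (real (card R)) \<ge> 0"
      using card_R_pos by simp
    then have "G > 0"
      unfolding G_def by simp
    moreover have "energy3 \<le> G * t ^ 3"
      unfolding G_def t_def using energy3_bound[OF assms(3) True] by (simp add: algebra_simps)
    ultimately have "t ^ 21 \<le> 16 * G ^ 5 * of_int p ^ 10 \<or> t ^ 57 \<le> 4096 * G ^ 17 * of_int p ^ 28"
      using small_subgroup_arith[of t "real (card RR)" "of_int p" \<rho> energy2 G energy3]
        t S p energy2_nonneg energy2_sq_le SE FT_R_fourth_bound[OF \<xi>(1)] II FT_R_power4_le[OF \<xi>(1)]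
      unfolding t_def \<rho>_def by simp
    then show ?thesis
      by blast
  next
    case False
    then have "real_of_int (p ^ 3) \<le> real_of_int (int (16 * card R ^ 5))"
      by (simp only: of_int_le_iff)
    then have large: "of_int p ^ 3 \<le> 16 * t ^ 5"
      unfolding t_def by simp
    \<comment> \<open>For A = R the orbit bound reads t |FT|^2 \<le> p t, which is the trivial
      square-root bound.\<close>
    have sq: "(norm (FT R \<eta>))\<^sup>2 \<le> of_int p" if "\<not> p dvd \<eta>" for \<eta>
      using FT_invariant_bound[OF invariant_R that] t unfolding t_def by (simp add: mult.commute)
    have "of_int p \<le> (4 ^ 5 * 16 ^ 12 :: real)"
      using large_subgroup_arith[of t "real (card RR)" "of_int p" \<rho> energy2]
        t S p energy2_nonneg SE energy2_le[OF sq] sq[OF \<xi>(1)] II large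
      unfolding t_def \<rho>_def by simp
    then show ?thesis
      by blast
  qed
qed

section \<open>Translation to the sixfold sumset\<close>

lemma inverse_in_R:
  assumes "c \<in> R"
  obtains d where "d \<in> R" "[c * d = 1] (mod p)"
proof -
  have "1 \<in> (\<lambda>r. c * r mod p) ` R"
    using bij_mult_R[OF assms] one_in unfolding bij_betw_def by simp
  then obtain d where "d \<in> R" "c * d mod p = 1"
    by auto
  then have "[c * d = 1] (mod p)"
    using p_gt_1 by (simp add: unique_euclidean_semiring_class.cong_def)
  with \<open>d \<in> R\<close> show ?thesis
    using that by blast
qed

lemma sumset_6I:
  assumes "a1 \<in> R" "a2 \<in> R" "a3 \<in> R" "a4 \<in> R" "a5 \<in> R" "a6 \<in> R"
  shows "(a1 + a2 + a3 + a4 + a5 + a6) mod p \<in> sumset (residue_ring p) 6 R"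
proof -
  have Suc: "(x + r) mod p \<in> sumset (residue_ring p) (Suc k) R"
    if "x mod p \<in> sumset (residue_ring p) k R" "r \<in> R" for x r k
  proof -
    have "(x + r) mod p = x mod p \<oplus>\<^bsub>residue_ring p\<^esub> r"
      by (simp add: residue_ring_def mod_simps)
    then show ?thesis
      using that by auto
  qed
  have "0 mod p \<in> sumset (residue_ring p) 0 R"
    by (simp add: residue_ring_def)
  then have "(0 + a1 + a2 + a3 + a4 + a5 + a6) mod p \<in> sumset (residue_ring p) (Suc (Suc (Suc (Suc (Suc (Suc 0)))))) R"
    by (intro Suc assms)
  moreover have "6 = Suc (Suc (Suc (Suc (Suc (Suc 0)))))"
    by simp
  ultimately show ?thesis
    by (simp only: add_0)
qed

text \<open>Multiplying x + y + a + b = l c by the inverse of c, which lies in R, turns it into a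
  representation of l by six elements of R.\<close>

lemma no_representation_if_notin_sumset:
  assumes "l \<in> {1..<p}" "l \<notin> sumset (residue_ring p) 6 R"
    and "x \<in> RR" "y \<in> RR" "a \<in> R" "b \<in> R" "c \<in> R"
  shows "\<not> [x + y + a + b = l * c] (mod p)"
proof
  assume eq: "[x + y + a + b = l * c] (mod p)"
  obtain d where d: "d \<in> R" "[c * d = 1] (mod p)"
    using inverse_in_R[OF assms(7)] by blast
  obtain x1 x2 y1 y2 where R: "x1 \<in> R" "x2 \<in> R" "y1 \<in> R" "y2 \<in> R"
    and xy: "x = (x1 + x2) mod p" "y = (y1 + y2) mod p"
    using assms(3,4) unfolding RR_def by auto
  let ?m = "\<lambda>r. d * r mod p"
  have "[?m x1 + ?m x2 + ?m y1 + ?m y2 + ?m a + ?m b = d * x1 + d * x2 + d * y1 + d * y2 + d * a + d * b] (mod p)"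
    by (intro cong_add) simp_all
  moreover have "[d * (x + y + a + b) = d * ((x1 + x2) + (y1 + y2) + a + b)] (mod p)"
    unfolding xy by (intro cong_mult[OF cong_refl] cong_add) simp_all
  moreover have "d * ((x1 + x2) + (y1 + y2) + a + b) = d * x1 + d * x2 + d * y1 + d * y2 + d * a + d * b"
    by (simp add: algebra_simps)
  ultimately have "(?m x1 + ?m x2 + ?m y1 + ?m y2 + ?m a + ?m b) mod p = (d * (x + y + a + b)) mod p"
    by (simp add: unique_euclidean_semiring_class.cong_def)
  also have "\<dots> = (d * (l * c)) mod p"
    using cong_mult[OF cong_refl[of d p] eq] by (simp add: unique_euclidean_semiring_class.cong_def)
  also have "\<dots> = (l * (c * d)) mod p"
    by (simp add: mult_ac)
  also have "\<dots> = l * 1 mod p"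
    using cong_mult[OF cong_refl[of l p] d(2)] by (simp add: unique_euclidean_semiring_class.cong_def)
  also have "\<dots> = l"
    using assms(1) by simp
  finally show False
    using sumset_6I[of "?m x1" "?m x2" "?m y1" "?m y2" "?m a" "?m b"] mult_closed[OF d(1)] R assms
    by simp
qed

end

lemma prime_field_subgroup_if_subgroup:
  fixes p :: nat
  assumes "prime p" "subgroup R (mult_of (residue_ring (int p)))"
  shows "prime_field_subgroup (int p) R"
proof
  interpret subgroup R "mult_of (residue_ring (int p))"
    by (rule assms(2))
  show "Factorial_Ring.prime (int p)"
    using assms(1) by simp
  show "R \<subseteq> {1..<int p}"
    using subset by (auto simp: residue_ring_def)
  show "1 \<in> R"
    using one_closed assms(1) prime_gt_1_nat by (simp add: residue_ring_def)
  show "a * b mod int p \<in> R" if "a \<in> R" "b \<in> R" for a b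
    using m_closed[OF that] by (simp add: residue_ring_def)
qed

theorem theorem4p1:
  fixes \<kappa> :: real
  assumes "\<kappa> > 41 / 83"
  shows "\<exists>p0::nat. \<forall>p::nat. \<forall>R :: int set.
           prime p \<longrightarrow> p \<ge> p0 \<longrightarrow>
           subgroup R (mult_of (residue_ring (int p))) \<longrightarrow>
           real (card R) \<ge> (real p) powr \<kappa> \<longrightarrow>
           carrier (mult_of (residue_ring (int p))) \<subseteq> sumset (residue_ring (int p)) 6 R"
proof -
  \<comment> \<open>The exponent 41/83 leaves room for the logarithms in both alternatives: 21 * 41
    = 861 > 830 = 10 * 83 and 57 * 41 = 2337 > 2324 = 28 * 83.\<close>
  have "eventually (\<lambda>x::real. 16 \<le> x powr (41 / 83)) at_top"
    by real_asymp
  moreover have "eventually (\<lambda>x::real. 4 ^ 5 * 16 ^ 12 < x) at_top"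
    by (rule eventually_gt_at_top)
  moreover have "eventually (\<lambda>x::real. 16 * (96001 * (1 + ln x)) ^ 5 * x ^ 10 < x powr (21 * 41 / 83)) at_top"
    by real_asymp
  moreover have "eventually (\<lambda>x::real. 4096 * (96001 * (1 + ln x)) ^ 17 * x ^ 28 < x powr (57 * 41 / 83)) at_top"
    by real_asymp
  ultimately have "eventually (\<lambda>x::real. 16 \<le> x powr (41 / 83) \<and> 4 ^ 5 * 16 ^ 12 < x
      \<and> 16 * (96001 * (1 + ln x)) ^ 5 * x ^ 10 < x powr (21 * 41 / 83)
      \<and> 4096 * (96001 * (1 + ln x)) ^ 17 * x ^ 28 < x powr (57 * 41 / 83)) at_top"
    by eventually_elim blast
  then obtain X where X: "\<And>x::real. x \<ge> X \<Longrightarrow> 16 \<le> x powr (41 / 83) \<and> 4 ^ 5 * 16 ^ 12 < x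
      \<and> 16 * (96001 * (1 + ln x)) ^ 5 * x ^ 10 < x powr (21 * 41 / 83)
      \<and> 4096 * (96001 * (1 + ln x)) ^ 17 * x ^ 28 < x powr (57 * 41 / 83)"
    unfolding eventually_at_top_linorder by blast
  show ?thesis
  proof (intro exI[of _ "nat \<lceil>X\<rceil>"] allI impI subsetI)
    fix p R l
    assume p: "prime p" "p \<ge> nat \<lceil>X\<rceil>" and sub: "subgroup R (mult_of (residue_ring (int p)))"
      and R: "real (card R) \<ge> real p powr \<kappa>" and l: "l \<in> carrier (mult_of (residue_ring (int p)))"
    interpret prime_field_subgroup "int p" R
      using p(1) sub by (rule prime_field_subgroup_if_subgroup)
    define t where "t = real (card R)"
    have p1: "real p > 1"
      using p(1) prime_gt_1_nat by simp
    have "real p \<ge> X"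
      using p(2) by linarith
    note X = X[OF this]
    then have X21: "16 * (96001 * (1 + ln (real p))) ^ 5 * real p ^ 10 < real p powr (21 * 41 / 83)"
      and X57: "4096 * (96001 * (1 + ln (real p))) ^ 17 * real p ^ 28 < real p powr (57 * 41 / 83)"
      by blast+
    have t: "t \<ge> real p powr (41 / 83)"
      unfolding t_def using powr_mono[of "41 / 83" \<kappa> "real p"] assms p1 R by linarith
    have tpow: "t ^ n \<ge> real p powr (real n * 41 / 83)" for n
    proof -
      have "real p powr (real n * 41 / 83) = (real p powr (41 / 83)) ^ n"
        using p1 by (simp add: powr_realpow[symmetric] powr_powr mult.commute)
      also have "\<dots> \<le> t ^ n"
        using t by (intro power_mono) auto
      finally show ?thesis .
    qed
    have card16: "16 \<le> card R"
      using t X unfolding t_def by linarith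
    have "card R \<le> card {1..<int p}"
      using R_subset by (intro card_mono) auto
    then have "card R \<le> p"
      by simp
    define G where "G = 96001 * (1 + ln (real (card R)))"
    have "ln (real (card R)) \<le> ln (real p)" "ln (real (card R)) \<ge> 0"
      using \<open>card R \<le> p\<close> card16 by simp_all
    then have G: "0 \<le> G" "G \<le> 96001 * (1 + ln (real p))"
      unfolding G_def by simp_all
    have c1: "\<not> t ^ 21 \<le> 16 * G ^ 5 * real p ^ 10"
    proof -
      have "16 * G ^ 5 * real p ^ 10 \<le> 16 * (96001 * (1 + ln (real p))) ^ 5 * real p ^ 10"
        using G by (intro mult_right_mono mult_left_mono power_mono) auto
      moreover have "real p powr (21 * 41 / 83) \<le> t ^ 21"
        using tpow[of 21] by simp
      ultimately show ?thesis
        using X21 by linarith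
    qed
    have c2: "\<not> t ^ 57 \<le> 4096 * G ^ 17 * real p ^ 28"
    proof -
      have "4096 * G ^ 17 * real p ^ 28 \<le> 4096 * (96001 * (1 + ln (real p))) ^ 17 * real p ^ 28"
        using G by (intro mult_right_mono mult_left_mono power_mono) auto
      moreover have "real p powr (57 * 41 / 83) \<le> t ^ 57"
        using tpow[of 57] by simp
      ultimately show ?thesis
        using X57 by linarith
    qed
    have l': "l \<in> {1..<int p}"
      using l by (auto simp: residue_ring_def)
    show "l \<in> sumset (residue_ring (int p)) 6 R"
    proof (rule ccontr)
      assume "l \<notin> sumset (residue_ring (int p)) 6 R"
      then show False
        using no_representation_cases[OF not_dvd_residue[OF l'] no_representation_if_notin_sumset[OF l'] card16] c1 c2 X
        unfolding t_def G_def by auto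
    qed
  qed
qed

end
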